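(* Let $K$ be a field and let $n,d$ be positive integers with $d<n$. Let $I_{1,n,d}\subset S=K[x_1,\ldots,x_n]$ be the ideal generated by all squarefree monomials of degree $d$. Then $I_{1,n,d}$ is Freiman if and only if one of the following conditions holds: (a) $n=2$ and $d=1$; (b) $n\geq 3$ and either $d=1$ or $d=n-1$.
   Context: For positive integers $k,n,d$ with $k\leq d$ and $kn>d$, the Veronese type ideal with constant bound $k$ is the monomial ideal $I_{k,n,d}\subset S=K[x_1,\ldots,x_n]$ whose minimal monomial generators are the monomials $x_1^{b_1}\cdots x_n^{b_n}$ with $\sum_{i=1}^n b_i=d$ and $0\leq b_i\leq k$ for all $i$. For $k=1$ these are the squarefree monomials of degree $d$. For an equigenerated monomial ideal $I\subset S$ (all minimal generators of the same degree), let $\mu(I)$ denote its minimal number of generators and $\ell(I)$ its analytic spread, i.e. the Krull dimension of the fiber cone $F(I)=\bigoplus_{j\ge 0} I^j/\mathfrak{m}I^j$, where $\mathfrak{m}=(x_1,\ldots,x_n)$. The ideal $I$ is called Freiman if $\mu(I^2)=\ell(I)\mu(I)-\binom{\ell(I)}{2}$. *)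

theory Defs
  imports
    "HOL-Algebra.Algebraic_Closure_Type"
    "HOL-Algebra.Ideal_Product"
    "HOL-Library.Poly_Mapping"
    "HOL-Library.Extended_Nat"
    "HOL-Library.Cardinality"
begin

text \<open>
  The supremum is taken in \<^typ>\<open>enat\<close>, so rings with unbounded chains have dimension
  \<open>\<infinity>\<close>; a ring without prime ideals (the zero ring) gets dimension \<open>0\<close>.
\<close>

definition krull_dim :: "('a, 'b) ring_scheme \<Rightarrow> enat" where
  "krull_dim R = (SUP l \<in> {l :: nat. \<exists>P. (\<forall>i\<le>l. primeideal (P i) R) \<and> (\<forall>i<l. P i \<subset> P (Suc i))}. enat l)"

text \<open>
  Only meant for finitely generated ideals; otherwise the value is unspecified.
\<close>

definition min_gens :: "('a, 'b) ring_scheme \<Rightarrow> 'a set \<Rightarrow> nat" where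
  "min_gens R I = (LEAST r. \<exists>G. G \<subseteq> carrier R \<and> finite G \<and> card G = r \<and> Idl\<^bsub>R\<^esub> G = I)"

text \<open>
  \<open>I [^]\<^bsub>ideals_set R\<^esub> j\<close> is the \<open>j\<close>-th power of the ideal \<open>I\<close>, with
  \<open>I\<^sup>0 = R\<close>.  An element of the direct sum of the quotients \<open>I\<^sup>j / M I\<^sup>j\<close> is a family \<open>f\<close>
  of cosets, \<open>f j\<close> being a coset of \<open>M I\<^sup>j\<close> in \<open>I\<^sup>j\<close>, almost all of them zero.  The product
  is induced by \<open>(a + M I\<^sup>i) (b + M I\<^sup>l) = a b + M I\<^bsup>i+l\<^esup>\<close>; as in \<^const>\<open>rcoset_mult\<close>, it is
  expressed as a union over all choices of representatives.
\<close>

definition fiber_cone :: "('a, 'b) ring_scheme \<Rightarrow> 'a set \<Rightarrow> 'a set \<Rightarrow> (nat \<Rightarrow> 'a set) ring" where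
  "fiber_cone R M I =
    (let Ipow = (\<lambda>j::nat. I [^]\<^bsub>ideals_set R\<^esub> j);
         MI = (\<lambda>j. M \<cdot>\<^bsub>R\<^esub> Ipow j)
     in \<lparr>carrier = {f. (\<forall>j. f j \<in> (\<lambda>x. MI j +>\<^bsub>R\<^esub> x) ` Ipow j) \<and> finite {j. f j \<noteq> MI j}},
         monoid.mult = (\<lambda>f g j. \<Union>a \<in> Pi UNIV f. \<Union>b \<in> Pi UNIV g.
                   MI j +>\<^bsub>R\<^esub> (\<Oplus>\<^bsub>R\<^esub>i\<in>{..j}. a i \<otimes>\<^bsub>R\<^esub> b (j - i))),
         one = (\<lambda>j. if j = 0 then MI 0 +>\<^bsub>R\<^esub> \<one>\<^bsub>R\<^esub> else MI j),
         ring.zero = MI,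
         ring.add = (\<lambda>f g j. f j <+>\<^bsub>R\<^esub> g j)\<rparr>)"

type_synonym ('n, 'k) mpoly = "('n \<Rightarrow>\<^sub>0 nat) \<Rightarrow>\<^sub>0 'k"

abbreviation mpoly_ring :: "('n::finite, 'k::field) mpoly ring" where
  "mpoly_ring \<equiv> ring_of_type_algebra"

definition irrelevant_ideal :: "('n::finite, 'k::field) mpoly set" where
  "irrelevant_ideal = Idl\<^bsub>mpoly_ring\<^esub> (range (\<lambda>i. Poly_Mapping.single (Poly_Mapping.single i 1) 1))"

definition analytic_spread :: "('n::finite, 'k::field) mpoly set \<Rightarrow> enat" where
  "analytic_spread I = krull_dim (fiber_cone mpoly_ring irrelevant_ideal I)"

text \<open>
  The equation is read in the integers; requiring \<open>analytic_spread I = enat l\<close> merely gives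
  the (always finite) analytic spread a name of type \<^typ>\<open>nat\<close>.  The notion is intended
  for equigenerated monomial ideals.
\<close>

definition freiman :: "('n::finite, 'k::field) mpoly set \<Rightarrow> bool" where
  "freiman I \<longleftrightarrow> (\<exists>l. analytic_spread I = enat l \<and>
     int (min_gens mpoly_ring (I [^]\<^bsub>ideals_set mpoly_ring\<^esub> (2::nat))) =
       int l * int (min_gens mpoly_ring I) - int (l choose 2))"

text \<open>
  \<^term>\<open>Poly_Mapping.single b 1\<close> is the monomial with exponent vector \<open>b\<close>; the number of
  variables is the cardinality of the index type \<open>'n\<close>.  All generators have the same degree,
  so they are the minimal monomial generators.
\<close>

definition veronese_ideal :: "nat \<Rightarrow> nat \<Rightarrow> ('n::finite, 'k::field) mpoly set" where
  "veronese_ideal k d = Idl\<^bsub>mpoly_ring\<^esub>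
     {Poly_Mapping.single b 1 | b.
       (\<Sum>i\<in>UNIV. Poly_Mapping.lookup b i) = d \<and> (\<forall>i. Poly_Mapping.lookup b i \<le> k)}"

end

theory Submission
  imports Defs
begin

text \<open>
  Write \<open>n\<close> for the number of variables and \<open>I\<close> for the ideal of the squarefree monomials of
  degree \<open>d\<close>, with \<open>0 < d < n\<close>.  The three numbers in the Freiman equation are
  \<open>\<mu>(I) = n choose d\<close>, \<open>\<ell>(I) = n\<close>, and \<open>\<mu>(I\<^sup>2)\<close>, the number of vectors in \<open>{0,1,2}\<^sup>n\<close> with
  coordinate sum \<open>2 d\<close>.

  \<^item> Numbers of generators (\<open>min_gens_monomial_ideal\<close>).  An ideal generated by monomials of one
    degree \<open>e\<close> is zero in degrees below \<open>e\<close>, so that multiplying by a polynomial acts on the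
    components of degree \<open>e\<close> through its constant term.  The components of degree \<open>e\<close> of any
    generating set therefore span the space with the given monomials as a basis.

  \<^item> The fiber cone (\<open>to_fiber_cone_iso\<close>).  For \<open>I\<close> generated by forms of degree \<open>d\<close>, an element of
    \<open>I\<^sup>j\<close> lies in \<open>\<mm> I\<^sup>j\<close> exactly when its component of degree \<open>j d\<close> vanishes.  Hence
    \<open>\<Oplus> I\<^sup>j / \<mm> I\<^sup>j\<close> is isomorphic to the subalgebra of \<open>K[x\<^sub>1, \<dots>, x\<^sub>n]\<close> spanned by the forms of
    degree \<open>j d\<close> in \<open>I\<^sup>j\<close>, and the analytic spread is the Krull dimension of that subalgebra.

  \<^item> Dimension at most \<open>n\<close> (\<open>krull_dim_subalgebra_le\<close>).  Choosing \<open>x\<^sub>i \<in> P\<^sub>i\<^sub>+\<^sub>1 - P\<^sub>i\<close> along a strict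
    chain of primes in a \<open>K\<close>-algebra gives algebraically independent elements: the lowest power of
    \<open>x\<^sub>0\<close> in a relation can be cancelled because \<open>x\<^sub>0 \<notin> P\<^sub>0\<close>, and modulo \<open>P\<^sub>1\<close> a relation between the
    remaining elements is left.  But \<open>n + 1\<close> polynomials in \<open>n\<close> variables are dependent, since
    their monomials with exponents at most \<open>N\<close> number \<open>(N + 1)\<^sup>n\<^sup>+\<^sup>1\<close> while they lie in a space of
    dimension \<open>O(N\<^sup>n)\<close>.

  \<^item> Dimension at least \<open>n\<close> (\<open>krull_dim_squarefree_algebra_ge\<close>).  The exponents that occur lie in
    the cone over the hypersimplex, \<open>0 \<le> d v\<^sub>i \<le> |v|\<close>.  Each face of a cone of exponents gives a
    monomial prime, spanned by the monomials off the face, and a complete flag of faces gives a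
    chain of \<open>n + 1\<close> primes.

  \<^item> Arithmetic (\<open>square_count_eq_iff\<close>).  Sorting the vectors of \<open>{0,1,2}\<^sup>n\<close> by their number of
    entries \<open>2\<close>, those with \<open>d\<close>, \<open>d - 1\<close> and \<open>d - 2\<close> such entries already outnumber
    \<open>n (n choose d) - (n choose 2)\<close> when \<open>2 \<le> d \<le> n - 2\<close>, while for \<open>d = 1\<close> and \<open>d = n - 1\<close> the
    sum collapses to \<open>(n choose 2) + n\<close>, which is the value required.
\<close>

section \<open>Polynomials as finitely supported functions\<close>

lemma poly_mapping_eq_sum_single:
  "p = (\<Sum>v\<in>Poly_Mapping.keys p. Poly_Mapping.single v (Poly_Mapping.lookup p v))"
proof (rule poly_mapping_eqI)
  fix k
  have "Poly_Mapping.lookup (\<Sum>v\<in>Poly_Mapping.keys p. Poly_Mapping.single v (Poly_Mapping.lookup p v)) k =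
     (\<Sum>v\<in>Poly_Mapping.keys p. if v = k then Poly_Mapping.lookup p v else 0)"
    by (simp add: lookup_sum lookup_single when_def)
  also have "\<dots> = Poly_Mapping.lookup p k"
    by (simp add: in_keys_iff)
  finally show "Poly_Mapping.lookup p k =
     Poly_Mapping.lookup (\<Sum>v\<in>Poly_Mapping.keys p. Poly_Mapping.single v (Poly_Mapping.lookup p v)) k" by simp
qed

lemma poly_mapping_times_eq_sum:
  fixes p q :: "'a::monoid_add \<Rightarrow>\<^sub>0 'b::semiring_0"
  shows "p * q = (\<Sum>u\<in>Poly_Mapping.keys p. \<Sum>w\<in>Poly_Mapping.keys q.
     Poly_Mapping.single (u + w) (Poly_Mapping.lookup p u * Poly_Mapping.lookup q w))"
  by (subst poly_mapping_eq_sum_single[of p], subst poly_mapping_eq_sum_single[of q])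
     (simp add: sum_product mult_single)

text \<open>
  Exponent vectors over an index type without an order have no canonical term order; an additive
  embedding \<open>r\<close> into an ordered monoid supplies one.  The product of the two terms with the largest
  exponents is then the only product of terms with its exponent, so nothing cancels it.
\<close>

lemma poly_mapping_no_zero_divisors:
  fixes r :: "'a::monoid_add \<Rightarrow> 'c::{ordered_cancel_comm_monoid_add, linorder}"
    and p q :: "'a \<Rightarrow>\<^sub>0 'b::semiring_no_zero_divisors"
  assumes "inj r" and add: "\<And>u w. r (u + w) = r u + r w"
    and pq: "p * q = 0"
  shows "p = 0 \<or> q = 0"
proof (rule ccontr)
  assume "\<not> ?thesis"
  then have ne: "Poly_Mapping.keys p \<noteq> {}" "Poly_Mapping.keys q \<noteq> {}" by auto
  have ex: "\<exists>u\<in>K. \<forall>u'\<in>K. r u' \<le> r u" if "finite K" "K \<noteq> {}" for K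
  proof -
    from that have "Max (r ` K) \<in> r ` K" by (intro Max_in) auto
    then obtain u where "u \<in> K" "r u = Max (r ` K)" by auto
    with that show ?thesis by (intro bexI[of _ u]) auto
  qed
  obtain u where u: "u \<in> Poly_Mapping.keys p" "\<And>u'. u' \<in> Poly_Mapping.keys p \<Longrightarrow> r u' \<le> r u"
    using ex[of "Poly_Mapping.keys p"] ne by auto
  obtain w where w: "w \<in> Poly_Mapping.keys q" "\<And>w'. w' \<in> Poly_Mapping.keys q \<Longrightarrow> r w' \<le> r w"
    using ex[of "Poly_Mapping.keys q"] ne by auto
  have uniq: "u' + w' = u + w \<longleftrightarrow> u' = u \<and> w' = w"
    if "u' \<in> Poly_Mapping.keys p" "w' \<in> Poly_Mapping.keys q" for u' w'
  proof
    assume "u' + w' = u + w"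
    then have "r u' + r w' = r u + r w" by (metis add)
    moreover have "r u' \<le> r u" "r w' \<le> r w" using that u w by auto
    ultimately have "r u' = r u" "r w' = r w"
      by (metis add_less_le_mono less_irrefl order_le_imp_less_or_eq)
         (metis \<open>r u' + r w' = r u + r w\<close> \<open>r u' \<le> r u\<close> \<open>r w' \<le> r w\<close> add_le_less_mono less_irrefl order_le_imp_less_or_eq)
    with \<open>inj r\<close> show "u' = u \<and> w' = w" by (auto dest: injD)
  qed auto
  have "Poly_Mapping.lookup (p * q) (u + w) = (\<Sum>u'\<in>Poly_Mapping.keys p. \<Sum>w'\<in>Poly_Mapping.keys q.
     if u' = u \<and> w' = w then Poly_Mapping.lookup p u' * Poly_Mapping.lookup q w' else 0)"
    unfolding poly_mapping_times_eq_sum lookup_sum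
    by (intro sum.cong refl) (auto simp: lookup_single when_def uniq)
  also have "\<dots> = (\<Sum>u'\<in>Poly_Mapping.keys p. if u' = u then
       (\<Sum>w'\<in>Poly_Mapping.keys q. if w' = w then Poly_Mapping.lookup p u' * Poly_Mapping.lookup q w' else 0) else 0)"
    by (intro sum.cong refl) auto
  also have "\<dots> = Poly_Mapping.lookup p u * Poly_Mapping.lookup q w"
    using u(1) w(1) by simp
  also have "\<dots> \<noteq> 0" using u(1) w(1) by (simp add: in_keys_iff)
  finally show False using pq by simp
qed

lemma mpoly_no_zero_divisors:
  fixes p q :: "('n::finite, 'k::field) mpoly"
  assumes "p * q = 0"
  shows "p = 0 \<or> q = 0"
proof -
  obtain \<sigma> :: "'n \<Rightarrow> nat" where \<sigma>: "inj \<sigma>"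
    using finite_imp_inj_to_nat_seg[of "UNIV :: 'n set"] by auto
  define r :: "('n \<Rightarrow>\<^sub>0 nat) \<Rightarrow> (nat \<Rightarrow>\<^sub>0 nat)"
    where "r v = (\<Sum>i\<in>UNIV. Poly_Mapping.single (\<sigma> i) (Poly_Mapping.lookup v i))" for v
  have "Poly_Mapping.lookup (r v) (\<sigma> i) = Poly_Mapping.lookup v i" for v i
  proof -
    have "Poly_Mapping.lookup (r v) (\<sigma> i) = (\<Sum>j\<in>UNIV. if j = i then Poly_Mapping.lookup v j else 0)"
      unfolding r_def lookup_sum
      by (intro sum.cong refl) (use \<sigma> in \<open>auto simp: lookup_single when_def dest: injD\<close>)
    then show ?thesis by simp
  qed
  then have "inj r"
    by (metis injI poly_mapping_eqI)
  moreover have "r (u + w) = r u + r w" for u w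
    by (simp add: r_def lookup_add single_add sum.distrib)
  ultimately show ?thesis using assms by (rule poly_mapping_no_zero_divisors)
qed

text \<open>
  Restricting a polynomial to the exponents in \<open>F\<close> serves two purposes: with \<open>F\<close> the set of
  exponents of a given degree it extracts a homogeneous component, and with \<open>F\<close> a face of a cone of
  exponents it is the ring homomorphism whose kernel is a monomial prime.
\<close>

definition part :: "'a set \<Rightarrow> ('a \<Rightarrow>\<^sub>0 'b::zero) \<Rightarrow> ('a \<Rightarrow>\<^sub>0 'b)" where
  "part F p = Poly_Mapping.mapp (\<lambda>v c. c when v \<in> F) p"

lemma lookup_part: "Poly_Mapping.lookup (part F p) v = (Poly_Mapping.lookup p v when v \<in> F)"
  by (auto simp: part_def lookup_mapp when_def in_keys_iff)

lemma keys_part [simp]: "Poly_Mapping.keys (part F p) = Poly_Mapping.keys p \<inter> F"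
  by (auto simp: in_keys_iff lookup_part)

lemma part_0 [simp]: "part F 0 = 0"
  by (rule poly_mapping_eqI) (simp add: lookup_part)

lemma part_add: "part F (p + q) = part F p + part F q"
  by (rule poly_mapping_eqI) (simp add: lookup_part lookup_add when_add_distrib)

lemma part_minus:
  fixes p q :: "'a \<Rightarrow>\<^sub>0 'b::ab_group_add"
  shows "part F (p - q) = part F p - part F q"
  by (rule poly_mapping_eqI) (simp add: lookup_part lookup_minus when_def)

lemma part_sum: "part F (sum f A) = (\<Sum>a\<in>A. part F (f a))"
  by (induction A rule: infinite_finite_induct) (auto simp: part_add)

lemma part_single: "part F (Poly_Mapping.single v c) = (Poly_Mapping.single v c when v \<in> F)"
  by (rule poly_mapping_eqI) (auto simp: lookup_part lookup_single when_def)

lemma part_part [simp]: "part F (part G p) = part (F \<inter> G) p"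
  by (rule poly_mapping_eqI) (auto simp: lookup_part when_def)

lemma part_eq_self_iff: "part F p = p \<longleftrightarrow> Poly_Mapping.keys p \<subseteq> F"
  by (auto simp: poly_mapping_eq_iff fun_eq_iff lookup_part when_def in_keys_iff)

lemma part_eq_0_iff: "part F p = 0 \<longleftrightarrow> Poly_Mapping.keys p \<inter> F = {}"
  by (metis keys_part keys_eq_empty)

text \<open>
  The hypothesis covers both uses: a face contains a sum exactly if it contains both summands, and
  a sum of exponents has the smallest possible degree exactly if both summands have.
\<close>

lemma part_times:
  fixes p q :: "'a::monoid_add \<Rightarrow>\<^sub>0 'b::semiring_0"
  assumes "\<And>u w. u \<in> Poly_Mapping.keys p \<Longrightarrow> w \<in> Poly_Mapping.keys q \<Longrightarrow>
    u + w \<in> F \<longleftrightarrow> u \<in> G \<and> w \<in> H"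
  shows "part F (p * q) = part G p * part H q"
proof -
  have *: "part G p = (\<Sum>u\<in>Poly_Mapping.keys p. part G (Poly_Mapping.single u (Poly_Mapping.lookup p u)))"
    for G and p :: "'a \<Rightarrow>\<^sub>0 'b"
    by (metis part_sum poly_mapping_eq_sum_single)
  show ?thesis
    unfolding poly_mapping_times_eq_sum[of p q] part_sum *[of G p] *[of H q] sum_product
    by (intro sum.cong refl) (auto simp: part_single mult_single when_def assms)
qed

definition total_deg :: "('n::finite \<Rightarrow>\<^sub>0 nat) \<Rightarrow> nat" where
  "total_deg v = (\<Sum>i\<in>UNIV. Poly_Mapping.lookup v i)"

lemma total_deg_add [simp]: "total_deg (u + w) = total_deg u + total_deg w"
  by (simp add: total_deg_def lookup_add sum.distrib)

lemma total_deg_0 [simp]: "total_deg 0 = 0"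
  by (simp add: total_deg_def)

lemma total_deg_eq_0_iff [simp]: "total_deg v = 0 \<longleftrightarrow> v = 0"
  by (auto simp: total_deg_def poly_mapping_eq_iff fun_eq_iff)

lemma lookup_le_total_deg: "Poly_Mapping.lookup v i \<le> total_deg v"
  unfolding total_deg_def by (rule member_le_sum) auto

abbreviation hom_comp :: "nat \<Rightarrow> ('n::finite, 'k::field) mpoly \<Rightarrow> ('n, 'k) mpoly" where
  "hom_comp m \<equiv> part {v. total_deg v = m}"

text \<open>
  Bilinearity reduces the convolution formula to monomials, where a single index \<open>i\<close> contributes.
\<close>

lemma hom_comp_times:
  fixes p q :: "('n::finite, 'k::field) mpoly"
  shows "hom_comp m (p * q) = (\<Sum>i\<le>m. hom_comp i p * hom_comp (m - i) q)"
proof -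
  have *: "part G p = (\<Sum>u\<in>Poly_Mapping.keys p. part G (Poly_Mapping.single u (Poly_Mapping.lookup p u)))"
    for G and p :: "('n,'k) mpoly"
    by (metis part_sum poly_mapping_eq_sum_single)
  have "(\<Sum>i\<le>m. hom_comp i p * hom_comp (m - i) q) =
     (\<Sum>i\<le>m. \<Sum>u\<in>Poly_Mapping.keys p. \<Sum>w\<in>Poly_Mapping.keys q.
        hom_comp i (Poly_Mapping.single u (Poly_Mapping.lookup p u)) *
        hom_comp (m - i) (Poly_Mapping.single w (Poly_Mapping.lookup q w)))"
    by (subst *[of _ p], subst *[of _ q]) (simp only: sum_product)
  also have "\<dots> = (\<Sum>u\<in>Poly_Mapping.keys p. \<Sum>w\<in>Poly_Mapping.keys q. \<Sum>i\<le>m.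
        hom_comp i (Poly_Mapping.single u (Poly_Mapping.lookup p u)) *
        hom_comp (m - i) (Poly_Mapping.single w (Poly_Mapping.lookup q w)))"
    by (subst sum.swap, intro sum.cong refl, subst sum.swap) simp
  also have "\<dots> = (\<Sum>u\<in>Poly_Mapping.keys p. \<Sum>w\<in>Poly_Mapping.keys q.
       hom_comp m (Poly_Mapping.single (u + w) (Poly_Mapping.lookup p u * Poly_Mapping.lookup q w)))"
  proof (intro sum.cong refl)
    fix u w
    have "(\<Sum>i\<le>m. hom_comp i (Poly_Mapping.single u (Poly_Mapping.lookup p u)) *
        hom_comp (m - i) (Poly_Mapping.single w (Poly_Mapping.lookup q w))) =
      (\<Sum>i\<le>m. if i = total_deg u then hom_comp i (Poly_Mapping.single u (Poly_Mapping.lookup p u)) *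
        hom_comp (m - i) (Poly_Mapping.single w (Poly_Mapping.lookup q w)) else 0)"
      by (intro sum.cong refl) (auto simp: part_single)
    also have "\<dots> = hom_comp m (Poly_Mapping.single (u + w) (Poly_Mapping.lookup p u * Poly_Mapping.lookup q w))"
      by (auto simp: part_single mult_single when_def)
    finally show "(\<Sum>i\<le>m. hom_comp i (Poly_Mapping.single u (Poly_Mapping.lookup p u)) *
        hom_comp (m - i) (Poly_Mapping.single w (Poly_Mapping.lookup q w))) =
        hom_comp m (Poly_Mapping.single (u + w) (Poly_Mapping.lookup p u * Poly_Mapping.lookup q w))" .
  qed
  also have "\<dots> = hom_comp m (p * q)"
    unfolding poly_mapping_times_eq_sum[of p q] part_sum ..
  finally show ?thesis by simp
qed

section \<open>Ideals and minimal numbers of generators\<close>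

lemma type_algebra_simps [simp]:
  "carrier ring_of_type_algebra = UNIV"
  "x \<otimes>\<^bsub>ring_of_type_algebra\<^esub> y = x * y"
  "x \<oplus>\<^bsub>ring_of_type_algebra\<^esub> y = x + y"
  "\<one>\<^bsub>ring_of_type_algebra\<^esub> = 1"
  "\<zero>\<^bsub>ring_of_type_algebra\<^esub> = 0"
  by (simp_all add: ring_of_type_algebra_def)

lemma ideal_type_algebra_iff:
  fixes I :: "'a::comm_ring_1 set"
  shows "ideal I ring_of_type_algebra \<longleftrightarrow>
    0 \<in> I \<and> (\<forall>a\<in>I. \<forall>b\<in>I. a + b \<in> I) \<and> (\<forall>s. \<forall>a\<in>I. s * a \<in> I)" (is "?L \<longleftrightarrow> ?R")
proof
  interpret R: cring "ring_of_type_algebra :: 'a ring" by (rule cring_from_type_algebra)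
  assume ?L
  then interpret ideal I ring_of_type_algebra .
  show ?R using zero_closed a_closed I_l_closed by auto
next
  interpret R: cring "ring_of_type_algebra :: 'a ring" by (rule cring_from_type_algebra)
  assume R: ?R
  then have neg: "- a \<in> I" if "a \<in> I" for a using that by (metis mult_minus1)
  show ?L
  proof (rule idealI)
    show "subgroup I (add_monoid (ring_of_type_algebra :: 'a ring))"
    proof (rule R.add.subgroupI)
      fix a assume "a \<in> I"
      have "\<ominus>\<^bsub>ring_of_type_algebra\<^esub> a = - a"
        by (rule R.minus_equality) auto
      then show "\<ominus>\<^bsub>ring_of_type_algebra\<^esub> a \<in> I"
        using neg[OF \<open>a \<in> I\<close>] by simp
    qed (use R in auto)
    show "a \<otimes>\<^bsub>ring_of_type_algebra\<^esub> x \<in> I" if "a \<in> I" for a x :: 'a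
      using R that by (simp add: mult.commute[of a])
  qed (use R in \<open>auto simp: R.ring_axioms\<close>)
qed

lemma ideal_type_algebra_minus:
  fixes a b :: "'a::comm_ring_1"
  assumes "ideal I ring_of_type_algebra" "a \<in> I" "b \<in> I"
  shows "a - b \<in> I"
  using assms by (metis ideal_type_algebra_iff diff_conv_add_uminus mult_minus1)

lemma ideal_type_algebra_sum:
  fixes f :: "'b \<Rightarrow> 'a::comm_ring_1"
  assumes "ideal I ring_of_type_algebra" "\<And>x. x \<in> A \<Longrightarrow> f x \<in> I"
  shows "sum f A \<in> I"
  using assms(2) by (induction A rule: infinite_finite_induct)
    (use assms(1) in \<open>auto simp: ideal_type_algebra_iff\<close>)

lemma genideal_type_algebra:
  fixes G :: "'a::comm_ring_1 set"
  shows ideal_genideal_type_algebra: "ideal (Idl\<^bsub>ring_of_type_algebra\<^esub> G) ring_of_type_algebra"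
    and subset_genideal_type_algebra: "G \<subseteq> Idl\<^bsub>ring_of_type_algebra\<^esub> G"
    and genideal_type_algebra_least:
      "ideal J ring_of_type_algebra \<Longrightarrow> G \<subseteq> J \<Longrightarrow> Idl\<^bsub>ring_of_type_algebra\<^esub> G \<subseteq> J"
proof -
  interpret R: cring "ring_of_type_algebra :: 'a ring" by (rule cring_from_type_algebra)
  show "ideal (Idl\<^bsub>ring_of_type_algebra\<^esub> G) ring_of_type_algebra"
    by (rule R.genideal_ideal) auto
  show "G \<subseteq> Idl\<^bsub>ring_of_type_algebra\<^esub> G" by (rule R.genideal_self) auto
  show "ideal J ring_of_type_algebra \<Longrightarrow> G \<subseteq> J \<Longrightarrow> Idl\<^bsub>ring_of_type_algebra\<^esub> G \<subseteq> J"
    by (rule R.genideal_minimal)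
qed

abbreviation monomial :: "'a \<Rightarrow> ('a \<Rightarrow>\<^sub>0 'k::zero_neq_one)" where
  "monomial v \<equiv> Poly_Mapping.single v 1"

definition monomial_ideal :: "('n::finite \<Rightarrow>\<^sub>0 nat) set \<Rightarrow> ('n, 'k::field) mpoly set" where
  "monomial_ideal B = Idl\<^bsub>mpoly_ring\<^esub> (monomial ` B)"

lemma vector_space_mpoly:
  "vector_space (\<lambda>(c::'k::field) (p::('n::finite,'k) mpoly). Poly_Mapping.single 0 c * p)"
  by unfold_locales
    (auto simp: distrib_left single_add distrib_right mult_single mult.assoc[symmetric])

lemma inj_monomial: "inj_on (monomial :: 'a \<Rightarrow> 'a \<Rightarrow>\<^sub>0 'k::zero_neq_one) B"
proof (rule inj_onI)
  fix u w :: 'a assume "(monomial u :: 'a \<Rightarrow>\<^sub>0 'k) = monomial w"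
  then have "Poly_Mapping.keys (monomial u :: 'a \<Rightarrow>\<^sub>0 'k) = Poly_Mapping.keys (monomial w :: 'a \<Rightarrow>\<^sub>0 'k)"
    by (rule arg_cong)
  then show "u = w" by simp
qed

lemma keys_times_total_deg_ge:
  fixes s a :: "('n::finite, 'k::field) mpoly"
  assumes "\<And>v. v \<in> Poly_Mapping.keys a \<Longrightarrow> e \<le> total_deg v" "v \<in> Poly_Mapping.keys (s * a)"
  shows "e \<le> total_deg v"
  using assms keys_mult[of s a] by (fastforce intro: trans_le_add2)

lemma hom_comp_times_const:
  fixes s a :: "('n::finite, 'k::field) mpoly"
  assumes "\<And>v. v \<in> Poly_Mapping.keys a \<Longrightarrow> e \<le> total_deg v"
  shows "hom_comp e (s * a) = Poly_Mapping.single 0 (Poly_Mapping.lookup s 0) * hom_comp e a"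
proof -
  have "hom_comp e (s * a) = part {0} s * hom_comp e a"
  proof (rule part_times)
    fix u w assume "w \<in> Poly_Mapping.keys a"
    then have "e \<le> total_deg w" by (rule assms)
    then show "u + w \<in> {v. total_deg v = e} \<longleftrightarrow> u \<in> {0} \<and> w \<in> {v. total_deg v = e}"
      using total_deg_eq_0_iff[of u] by auto
  qed
  moreover have "part {0} s = Poly_Mapping.single 0 (Poly_Mapping.lookup s 0)"
    by (rule poly_mapping_eqI) (auto simp: lookup_part lookup_single when_def)
  ultimately show ?thesis by simp
qed

text \<open>
  Passing to components of degree \<open>e\<close> turns generation as an ideal into generation as a vector
  space, where the monomials are independent and cannot be spanned by fewer elements.
\<close>

theorem min_gens_monomial_ideal:
  fixes B :: "('n::finite \<Rightarrow>\<^sub>0 nat) set"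
  assumes "finite B" and deg_B: "\<And>b. b \<in> B \<Longrightarrow> total_deg b = e"
  shows "min_gens mpoly_ring (monomial_ideal B :: ('n, 'k::field) mpoly set) = card B"
proof -
  let ?I = "monomial_ideal B :: ('n, 'k) mpoly set"
  let ?m = "monomial :: ('n \<Rightarrow>\<^sub>0 nat) \<Rightarrow> ('n, 'k) mpoly"
  interpret V: vector_space "\<lambda>(c::'k) (p::('n,'k) mpoly). Poly_Mapping.single 0 c * p"
    by (rule vector_space_mpoly)
  have indep: "V.independent (?m ` B)"
  proof
    assume "V.dependent (?m ` B)"
    then obtain u b where ub: "b \<in> B" "u (?m b) \<noteq> 0"
      and "(\<Sum>v\<in>?m ` B. Poly_Mapping.single 0 (u v) * v) = 0"
      using \<open>finite B\<close> by (subst (asm) V.dependent_finite) auto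
    then have "(\<Sum>c\<in>B. Poly_Mapping.single c (u (?m c))) = 0"
      by (subst (asm) sum.reindex[OF inj_monomial]) (simp add: mult_single)
    then have "(\<Sum>c\<in>B. Poly_Mapping.lookup (Poly_Mapping.single c (u (?m c))) b) = 0"
      by (metis lookup_sum lookup_zero)
    then show False using ub \<open>finite B\<close> by (simp add: lookup_single when_def)
  qed
  have lower: "card B \<le> card G" if G: "finite G" "Idl\<^bsub>mpoly_ring\<^esub> G = ?I" for G
  proof -
    have "ideal {a :: ('n,'k) mpoly. \<forall>v\<in>Poly_Mapping.keys a. e \<le> total_deg v} mpoly_ring"
      unfolding ideal_type_algebra_iff
    proof (intro conjI allI ballI)
      fix a b :: "('n,'k) mpoly"
      assume "a \<in> {a. \<forall>v\<in>Poly_Mapping.keys a. e \<le> total_deg v}" "b \<in> {a. \<forall>v\<in>Poly_Mapping.keys a. e \<le> total_deg v}"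
      then show "a + b \<in> {a. \<forall>v\<in>Poly_Mapping.keys a. e \<le> total_deg v}"
        using keys_add[of a b] by auto
    qed (auto intro: keys_times_total_deg_ge)
    then have I_deg: "?I \<subseteq> {a. \<forall>v\<in>Poly_Mapping.keys a. e \<le> total_deg v}"
      unfolding monomial_ideal_def by (rule genideal_type_algebra_least) (auto simp: deg_B)
    \<comment> \<open>The span condition defines an ideal because \<open>s\<close> acts on components of degree \<open>e\<close> by its
      constant term; hence it passes from \<open>G\<close> to all of the ideal.\<close>
    define J where "J = {a :: ('n,'k) mpoly. (\<forall>v\<in>Poly_Mapping.keys a. e \<le> total_deg v) \<and>
        hom_comp e a \<in> V.span (hom_comp e ` G)}"
    have "ideal J mpoly_ring"
    proof (unfold ideal_type_algebra_iff, intro conjI allI ballI)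
      show "0 \<in> J" by (simp add: J_def V.span_zero)
    next
      fix a b assume "a \<in> J" "b \<in> J"
      then show "a + b \<in> J"
        using keys_add[of a b] by (auto simp: J_def part_add intro: V.span_add)
    next
      fix s a assume "a \<in> J"
      then show "s * a \<in> J"
        by (auto simp: J_def hom_comp_times_const intro: V.span_scale keys_times_total_deg_ge)
    qed
    moreover have "G \<subseteq> J"
      using G I_deg subset_genideal_type_algebra[of G]
      by (auto simp: J_def intro!: V.span_base)
    ultimately have "?I \<subseteq> J"
      using genideal_type_algebra_least G by metis
    then have "?m ` B \<subseteq> J"
      using subset_genideal_type_algebra[of "?m ` B"] by (simp add: monomial_ideal_def)
    then have "?m ` B \<subseteq> V.span (hom_comp e ` G)"
      by (auto simp: J_def part_single deg_B)
    then have "card (?m ` B) \<le> card (hom_comp e ` G)"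
      using V.independent_span_bound[OF _ indep, of "hom_comp e ` G"] \<open>finite G\<close> by simp
    also have "\<dots> \<le> card G"
      using \<open>finite G\<close> by (rule card_image_le)
    also have "card (?m ` B) = card B"
      by (rule card_image[OF inj_monomial])
    finally show ?thesis .
  qed
  show ?thesis
    unfolding min_gens_def
  proof (rule Least_equality)
    show "\<exists>G\<subseteq>carrier mpoly_ring. finite G \<and> card G = card B \<and> Idl\<^bsub>mpoly_ring\<^esub> G = ?I"
      using \<open>finite B\<close> by (intro exI[of _ "?m ` B"]) (auto simp: monomial_ideal_def card_image inj_monomial)
  qed (use lower in auto)
qed

lemma ideal_prod_genideal:
  fixes S T :: "'a::comm_ring_1 set"
  shows "(Idl\<^bsub>ring_of_type_algebra\<^esub> S) \<cdot>\<^bsub>ring_of_type_algebra\<^esub> (Idl\<^bsub>ring_of_type_algebra\<^esub> T) =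
    Idl\<^bsub>ring_of_type_algebra\<^esub> ((\<lambda>(s, t). s * t) ` (S \<times> T))" (is "?I \<cdot>\<^bsub>_\<^esub> ?J = ?K")
proof
  interpret R: cring "ring_of_type_algebra :: 'a ring" by (rule cring_from_type_algebra)
  note K = ideal_genideal_type_algebra[of "(\<lambda>(s, t). s * t) ` (S \<times> T)", unfolded ideal_type_algebra_iff]
  have 1: "s * j \<in> ?K" if "s \<in> S" "j \<in> ?J" for s j
  proof -
    have "ideal {j. s * j \<in> ?K} ring_of_type_algebra"
      using K by (auto simp: ideal_type_algebra_iff distrib_left mult.left_commute)
    then have "?J \<subseteq> {j. s * j \<in> ?K}"
      by (rule genideal_type_algebra_least)
         (use that subset_genideal_type_algebra[of "(\<lambda>(s, t). s * t) ` (S \<times> T)"] in auto)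
    with that show ?thesis by auto
  qed
  have 2: "i * j \<in> ?K" if "i \<in> ?I" "j \<in> ?J" for i j
  proof -
    have "ideal {i. i * j \<in> ?K} ring_of_type_algebra"
      using K by (auto simp: ideal_type_algebra_iff distrib_right mult.assoc)
    then have "?I \<subseteq> {i. i * j \<in> ?K}"
      by (rule genideal_type_algebra_least) (use that 1 in auto)
    with that show ?thesis by auto
  qed
  show "?I \<cdot>\<^bsub>ring_of_type_algebra\<^esub> ?J \<subseteq> ?K"
  proof
    fix x assume "x \<in> ?I \<cdot>\<^bsub>ring_of_type_algebra\<^esub> ?J"
    then show "x \<in> ?K"
      by (induction rule: ideal_prod.induct) (use 2 K in auto)
  qed
  show "?K \<subseteq> ?I \<cdot>\<^bsub>ring_of_type_algebra\<^esub> ?J"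
  proof (rule genideal_type_algebra_least)
    show "ideal (?I \<cdot>\<^bsub>ring_of_type_algebra\<^esub> ?J) ring_of_type_algebra"
      by (intro R.ideal_prod_is_ideal ideal_genideal_type_algebra)
    show "(\<lambda>(s, t). s * t) ` (S \<times> T) \<subseteq> ?I \<cdot>\<^bsub>ring_of_type_algebra\<^esub> ?J"
    proof clarify
      fix s t assume "s \<in> S" "t \<in> T"
      then have "s \<in> ?I" "t \<in> ?J" using subset_genideal_type_algebra by blast+
      then show "s * t \<in> ?I \<cdot>\<^bsub>ring_of_type_algebra\<^esub> ?J"
        using ideal_prod.prod[of s ?I t ?J ring_of_type_algebra] by simp
    qed
  qed
qed

definition ideal_power :: "('n::finite, 'k::field) mpoly set \<Rightarrow> nat \<Rightarrow> ('n, 'k) mpoly set" where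
  "ideal_power I j = I [^]\<^bsub>ideals_set mpoly_ring\<^esub> j"

lemma ideal_power_0: "ideal_power I 0 = UNIV"
  by (simp add: ideal_power_def nat_pow_def ideals_set_def)

lemma ideal_power_Suc: "ideal_power I (Suc j) = ideal_power I j \<cdot>\<^bsub>mpoly_ring\<^esub> I"
  by (simp add: ideal_power_def nat_pow_def ideals_set_def)

lemma ideal_ideal_power:
  assumes "ideal I mpoly_ring" shows "ideal (ideal_power I j) mpoly_ring"
proof -
  interpret R: cring "mpoly_ring :: ('a, 'b) mpoly ring" by (rule cring_from_type_algebra)
  show ?thesis
  proof (induction j)
    case 0
    show ?case using R.oneideal by (simp add: ideal_power_0)
  next
    case (Suc j)
    then show ?case using assms by (simp add: ideal_power_Suc R.ideal_prod_is_ideal)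
  qed
qed

lemma ideal_power_1: 
  assumes "ideal I mpoly_ring" shows "ideal_power I (Suc 0) = I"
proof -
  interpret R: cring "mpoly_ring :: ('a, 'b) mpoly ring" by (rule cring_from_type_algebra)
  have "I \<cdot>\<^bsub>mpoly_ring\<^esub> carrier mpoly_ring = I"
    using assms by (rule R.ideal_prod_one)
  moreover have "I \<cdot>\<^bsub>mpoly_ring\<^esub> carrier mpoly_ring = carrier mpoly_ring \<cdot>\<^bsub>mpoly_ring\<^esub> I"
    using assms R.oneideal by (rule R.ideal_prod_commute)
  ultimately show ?thesis by (simp add: ideal_power_0 ideal_power_Suc)
qed

lemma monomial_ideal_square:
  "ideal_power (monomial_ideal B) 2 = monomial_ideal ((\<lambda>(a, b). a + b) ` (B \<times> B))"
proof -
  have "ideal_power (monomial_ideal B) 2 = (monomial_ideal B :: ('a, 'b) mpoly set) \<cdot>\<^bsub>mpoly_ring\<^esub> monomial_ideal B"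
    using ideal_power_1[of "monomial_ideal B :: ('a, 'b) mpoly set"] ideal_genideal_type_algebra[of "monomial ` B :: ('a, 'b) mpoly set"]
    by (simp add: numeral_2_eq_2 ideal_power_Suc[of _ "Suc 0"] monomial_ideal_def)
  also have "\<dots> = monomial_ideal ((\<lambda>(a, b). a + b) ` (B \<times> B))"
    unfolding monomial_ideal_def ideal_prod_genideal
    by (rule arg_cong[of _ _ "genideal _"]) (force simp: mult_single image_iff)
  finally show ?thesis .
qed

section \<open>Chains of primes in algebras of polynomials\<close>

lemma cring_subring_type_algebra_iff:
  fixes A :: "'a::comm_ring_1 set"
  shows "cring (ring_of_type_algebra\<lparr>carrier := A\<rparr>) \<longleftrightarrow>
    0 \<in> A \<and> 1 \<in> A \<and> (\<forall>a\<in>A. - a \<in> A) \<and> (\<forall>a\<in>A. \<forall>b\<in>A. a + b \<in> A \<and> a * b \<in> A)" (is "?L \<longleftrightarrow> ?R")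
proof
  assume ?L
  then interpret R: cring "ring_of_type_algebra\<lparr>carrier := A\<rparr>" .
  have "- a \<in> A" if a: "a \<in> A" for a
  proof -
    have "\<ominus>\<^bsub>ring_of_type_algebra\<lparr>carrier := A\<rparr>\<^esub> a \<in> A"
         "a + (\<ominus>\<^bsub>ring_of_type_algebra\<lparr>carrier := A\<rparr>\<^esub> a) = 0"
      using R.a_inv_closed[of a] R.r_neg[of a] a by auto
    then show ?thesis by (metis minus_unique)
  qed
  then show ?R
    using R.zero_closed R.one_closed R.a_closed R.m_closed by auto
next
  assume R: ?R
  have "abelian_group (ring_of_type_algebra\<lparr>carrier := A\<rparr>)"
    by (rule abelian_groupI) (use R in \<open>auto simp: algebra_simps intro!: bexI[of _ "- _"]\<close>)
  moreover have "comm_monoid (ring_of_type_algebra\<lparr>carrier := A\<rparr>)"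
    by (rule comm_monoidI) (use R in \<open>auto simp: algebra_simps\<close>)
  ultimately show ?L
    by (rule cringI) (use R in \<open>auto simp: algebra_simps\<close>)
qed

lemma ideal_subring_type_algebraI:
  fixes A P :: "'a::comm_ring_1 set"
  assumes "cring (ring_of_type_algebra\<lparr>carrier := A\<rparr>)" "P \<subseteq> A" "0 \<in> P"
    "\<And>a b. a \<in> P \<Longrightarrow> b \<in> P \<Longrightarrow> a + b \<in> P" "\<And>a b. a \<in> A \<Longrightarrow> b \<in> P \<Longrightarrow> a * b \<in> P"
  shows "ideal P (ring_of_type_algebra\<lparr>carrier := A\<rparr>)"
proof -
  interpret R: cring "ring_of_type_algebra\<lparr>carrier := A\<rparr>" by fact
  have A: "0 \<in> A" "1 \<in> A" "\<And>a. a \<in> A \<Longrightarrow> - a \<in> A"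
    using assms(1) by (simp_all add: cring_subring_type_algebra_iff)
  have neg: "- a \<in> P" if "a \<in> P" for a
    using assms(5)[of "- 1" a] that A by auto
  show ?thesis
  proof (rule idealI)
    show "subgroup P (add_monoid (ring_of_type_algebra\<lparr>carrier := A\<rparr>))"
    proof (rule R.add.subgroupI)
      fix a assume a: "a \<in> P"
      have "\<ominus>\<^bsub>ring_of_type_algebra\<lparr>carrier := A\<rparr>\<^esub> a = - a"
        by (rule R.minus_equality) (use a assms(2) A in auto)
      then show "\<ominus>\<^bsub>ring_of_type_algebra\<lparr>carrier := A\<rparr>\<^esub> a \<in> P"
        using neg[OF a] by simp
    qed (use assms in auto)
    show "a \<otimes>\<^bsub>ring_of_type_algebra\<lparr>carrier := A\<rparr>\<^esub> x \<in> P"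
      if "a \<in> P" "x \<in> carrier (ring_of_type_algebra\<lparr>carrier := A\<rparr>)" for a x
      using assms(5) that by (simp add: mult.commute[of a])
  qed (use assms in \<open>auto simp: R.ring_axioms\<close>)
qed

text \<open>
  Elementary form of primality in a subring of a commutative ring type, for use with the
  arithmetic of the type.
\<close>

lemma primeideal_subring_type_algebraD:
  fixes A P :: "'a::comm_ring_1 set"
  assumes "primeideal P (ring_of_type_algebra\<lparr>carrier := A\<rparr>)"
  shows "P \<subseteq> A" "0 \<in> P" "\<And>a b. a \<in> P \<Longrightarrow> b \<in> P \<Longrightarrow> a + b \<in> P"
    "\<And>a b. a \<in> A \<Longrightarrow> b \<in> P \<Longrightarrow> a * b \<in> P"
    "\<And>a b. a \<in> P \<Longrightarrow> b \<in> P \<Longrightarrow> a - b \<in> P"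
    "1 \<notin> P" "\<And>a b. a \<in> A \<Longrightarrow> b \<in> A \<Longrightarrow> a * b \<in> P \<Longrightarrow> a \<in> P \<or> b \<in> P"
proof -
  interpret primeideal P "ring_of_type_algebra\<lparr>carrier := A\<rparr>" by fact
  show "P \<subseteq> A" using a_subset by simp
  show "0 \<in> P" using additive_subgroup.zero_closed[OF is_additive_subgroup] by simp
  show add: "a + b \<in> P" if "a \<in> P" "b \<in> P" for a b
    using additive_subgroup.a_closed[OF is_additive_subgroup] that by simp
  show mult: "a * b \<in> P" if "a \<in> A" "b \<in> P" for a b using I_l_closed that by simp
  have "- 1 \<in> A" using is_cring by (simp add: cring_subring_type_algebra_iff)
  then show "a - b \<in> P" if "a \<in> P" "b \<in> P" for a b
    using add[of a "- b"] mult[of "- 1" b] that by simp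
  show "1 \<notin> P" using one_imp_carrier I_notcarr by auto
  show "a \<in> P \<or> b \<in> P" if "a \<in> A" "b \<in> A" "a * b \<in> P" for a b
    using I_prime that by simp
qed

text \<open>
  A relation between \<open>x\<^sub>k, \<dots>, x\<^sub>m\<^sub>-\<^sub>1\<close> modulo \<open>P\<^sub>k\<close> has the form \<open>\<Sum>\<^sub>s x\<^sub>k\<^sup>s R\<^sub>s\<close> with \<open>R\<^sub>s\<close> in the later
  elements.  If \<open>s\<close> is the least exponent that occurs, cancelling \<open>x\<^sub>k\<^sup>s \<notin> P\<^sub>k\<close> leaves
  \<open>R\<^sub>s + x\<^sub>k Y \<in> P\<^sub>k\<close> for some \<open>Y\<close>, so \<open>R\<^sub>s \<in> P\<^sub>k\<^sub>+\<^sub>1\<close> because \<open>x\<^sub>k \<in> P\<^sub>k\<^sub>+\<^sub>1\<close>.  This is a relation between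
  fewer elements modulo \<open>P\<^sub>k\<^sub>+\<^sub>1\<close>.  The relations are stated modulo \<open>P\<^sub>k\<close> for all \<open>k\<close> so that
  descending induction on \<open>k\<close> applies; \<open>k = 0\<close> gives algebraic independence.
\<close>

lemma prime_chain_algebraically_independent:
  fixes A :: "('n::finite, 'k::field) mpoly set" and P :: "nat \<Rightarrow> ('n, 'k) mpoly set"
  assumes prime: "\<And>i. i \<le> m \<Longrightarrow> primeideal (P i) (mpoly_ring\<lparr>carrier := A\<rparr>)"
    and chain: "\<And>i. i < m \<Longrightarrow> P i \<subseteq> P (Suc i)"
    and const: "\<And>c. Poly_Mapping.single 0 c \<in> A"
    and x: "\<And>i. i < m \<Longrightarrow> x i \<in> P (Suc i) - P i"
    and "k \<le> m"
    and "(\<Sum>e\<in>PiE {k..<m} (\<lambda>_. {..N}). Poly_Mapping.single 0 (c e) * (\<Prod>i\<in>{k..<m}. x i ^ e i)) \<in> P k"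
    and "e \<in> PiE {k..<m} (\<lambda>_. {..N})"
  shows "c e = 0"
proof -
  have A: "0 \<in> A" "1 \<in> A" "\<And>a b. a \<in> A \<Longrightarrow> b \<in> A \<Longrightarrow> a + b \<in> A" "\<And>a b. a \<in> A \<Longrightarrow> b \<in> A \<Longrightarrow> a * b \<in> A"
    using prime[of 0] by (auto simp: primeideal_def cring_subring_type_algebra_iff)
  have sumA: "sum f I \<in> A" if "\<And>a. a \<in> I \<Longrightarrow> f a \<in> A" for f :: "'b \<Rightarrow> ('n, 'k) mpoly" and I
    using that by (induction I rule: infinite_finite_induct) (auto simp: A)
  have prodA: "prod f I \<in> A" if "\<And>a. a \<in> I \<Longrightarrow> f a \<in> A" for f :: "'b \<Rightarrow> ('n, 'k) mpoly" and I
    using that by (induction I rule: infinite_finite_induct) (auto simp: A)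
  have powA: "a ^ t \<in> A" if "a \<in> A" for a t
    using that by (induction t) (auto simp: A)
  have xA: "x i \<in> A" if "i < m" for i
    using x[OF that] primeideal_subring_type_algebraD(1)[OF prime[of "Suc i"]] that by auto
  define E where "E j = PiE {j..<m} (\<lambda>_. {..N})" for j
  define xpow where "xpow j f = (\<Prod>i\<in>{j..<m}. x i ^ f i)" for j f
  have "\<forall>c. (\<Sum>e\<in>E k. Poly_Mapping.single 0 (c e) * xpow k e) \<in> P k \<longrightarrow> (\<forall>e\<in>E k. c e = 0)"
    using \<open>k \<le> m\<close>
  proof (induction k rule: inc_induct)
    case base
    show ?case
    proof (intro allI impI ballI)
      fix c e assume "(\<Sum>e\<in>E m. Poly_Mapping.single 0 (c e) * xpow m e) \<in> P m" and e: "e \<in> E m"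
      then have *: "Poly_Mapping.single 0 (c e) \<in> P m"
        by (auto simp: E_def xpow_def)
      show "c e = 0"
      proof (rule ccontr)
        assume "c e \<noteq> 0"
        then have "Poly_Mapping.single 0 (inverse (c e)) * Poly_Mapping.single 0 (c e) = (1 :: ('n, 'k) mpoly)"
          by (simp add: mult_single)
        then show False
          using * const primeideal_subring_type_algebraD(4,6)[OF prime[of m]] by (metis order_refl)
      qed
    qed
  next
    case (step k)
    then have k: "k \<le> m" "Suc k \<le> m" by simp_all
    note Pk = primeideal_subring_type_algebraD[OF prime[OF k(1)]]
    note PSk = primeideal_subring_type_algebraD[OF prime[OF k(2)]]
    show ?case
    proof (intro allI impI)
      fix c assume in_P: "(\<Sum>e\<in>E k. Poly_Mapping.single 0 (c e) * xpow k e) \<in> P k"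
      have ins: "{k..<m} = insert k {Suc k..<m}" using step by auto
      have E_k: "E k = (\<lambda>(s, e). e(k := s)) ` ({..N} \<times> E (Suc k))"
        unfolding E_def ins PiE_insert_eq by simp
      have inj: "inj_on (\<lambda>(s, e). e(k := s)) ({..N} \<times> E (Suc k))"
        unfolding E_def using inj_combinator[of k "{Suc k..<m}" "\<lambda>_. {..N}"] by simp
      have xpow_upd: "xpow k (e(k := s)) = x k ^ s * xpow (Suc k) e" for e s
        unfolding xpow_def ins by (subst prod.insert) (auto intro!: prod.cong)
      define R where "R s = (\<Sum>e\<in>E (Suc k). Poly_Mapping.single 0 (c (e(k := s))) * xpow (Suc k) e)" for s
      have RA: "R s \<in> A" for s
        unfolding R_def xpow_def by (intro sumA A const prodA powA xA) auto
      have "(\<Sum>e\<in>E k. Poly_Mapping.single 0 (c e) * xpow k e) = (\<Sum>s\<le>N. x k ^ s * R s)"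
        unfolding E_k sum.reindex[OF inj] R_def
        by (simp add: sum.cartesian_product sum_distrib_left xpow_upd o_def split_beta mult_ac)
      then have in_P: "(\<Sum>s\<le>N. x k ^ s * R s) \<in> P k" using in_P by simp
      have zero: "\<forall>e\<in>E (Suc k). c (e(k := s)) = 0" if "s \<le> N" for s
        using that
      proof (induction s rule: less_induct)
        case (less s)
        have "R t = 0" if "t < s" for t
          unfolding R_def using less.IH[OF that] less.prems that by (intro sum.neutral) (simp add: fun_upd_def)
        then have "(\<Sum>t\<le>N. x k ^ t * R t) = (\<Sum>t\<in>{s..N}. x k ^ t * R t)"
          by (intro sum.mono_neutral_right) auto
        also have "\<dots> = x k ^ s * R s + (\<Sum>t\<in>{Suc s..N}. x k ^ t * R t)"
          using less.prems by (simp add: sum.atLeast_Suc_atMost)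
        finally have split: "(\<Sum>t\<le>N. x k ^ t * R t) =
            x k ^ s * R s + (\<Sum>t\<in>{Suc s..N}. x k ^ t * R t)" .
        have "(\<Sum>t\<in>{Suc s..N}. x k ^ t * R t) =
            x k ^ s * (x k * (\<Sum>t\<in>{Suc s..N}. x k ^ (t - Suc s) * R t))"
          unfolding sum_distrib_left
        proof (intro sum.cong refl)
          fix t assume "t \<in> {Suc s..N}"
          then have "x k ^ t = x k ^ (s + Suc (t - Suc s))" by simp
          then show "x k ^ t * R t = x k ^ s * (x k * (x k ^ (t - Suc s) * R t))"
            by (simp add: power_add mult_ac)
        qed
        then have "x k ^ s * (R s + x k * (\<Sum>t\<in>{Suc s..N}. x k ^ (t - Suc s) * R t)) \<in> P k"
          using in_P unfolding split by (simp add: distrib_left)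
        moreover have Y: "(\<Sum>t\<in>{Suc s..N}. x k ^ (t - Suc s) * R t) \<in> A" (is "?Y \<in> A")
          using step by (intro sumA A powA xA RA) auto
        moreover have "x k ^ t \<notin> P k" for t
        proof (induction t)
          case 0 show ?case using Pk(6) step by simp
        next
          case (Suc t)
          then show ?case using Pk(7)[of "x k" "x k ^ t"] x[of k] xA[of k] powA step by auto
        qed
        ultimately have "R s + x k * ?Y \<in> P k"
          using Pk(7)[of "x k ^ s" "R s + x k * ?Y"] powA xA[of k] A RA step by fastforce
        then have "R s + x k * ?Y \<in> P (Suc k)" using chain step by auto
        moreover have "?Y * x k \<in> P (Suc k)"
          using PSk(4) Y x[of k] step by auto
        ultimately have "R s + x k * ?Y - ?Y * x k \<in> P (Suc k)"
          by (rule PSk(5))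
        then have "R s \<in> P (Suc k)" by (simp add: mult.commute)
        then show ?case
          using step.IH[rule_format, of "\<lambda>e. c (e(k := s))"] by (auto simp: R_def fun_upd_def)
      qed
      show "\<forall>e\<in>E k. c e = 0" unfolding E_k using zero by auto
    qed
  qed
  then show ?thesis using assms(6,7) by (auto simp: E_def xpow_def)
qed

lemma card_bounded_total_deg:
  fixes M :: nat
  shows "finite {v :: 'n::finite \<Rightarrow>\<^sub>0 nat. total_deg v \<le> M}" (is "finite ?V")
    and "card {v :: 'n::finite \<Rightarrow>\<^sub>0 nat. total_deg v \<le> M} \<le> Suc M ^ CARD('n)"
proof -
  have inj: "inj_on Poly_Mapping.lookup ?V" by (auto intro: inj_onI poly_mapping_eqI)
  have sub: "Poly_Mapping.lookup ` ?V \<subseteq> PiE UNIV (\<lambda>_. {..M})"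
    using lookup_le_total_deg order_trans by fastforce
  have fin: "finite (PiE (UNIV :: 'n set) (\<lambda>_. {..M}))" by (rule finite_PiE) auto
  then show "finite ?V" using inj sub finite_subset by (metis inj_on_finite)
  have "card ?V \<le> card (PiE (UNIV :: 'n set) (\<lambda>_. {..M}))"
    using card_inj_on_le[OF inj sub fin] .
  then show "card ?V \<le> Suc M ^ CARD('n)" by (simp add: card_PiE)
qed

lemma keys_power_total_deg_le:
  fixes p :: "('n::finite, 'k::field) mpoly"
  assumes "\<And>v. v \<in> Poly_Mapping.keys p \<Longrightarrow> total_deg v \<le> D" "v \<in> Poly_Mapping.keys (p ^ t)"
  shows "total_deg v \<le> t * D"
  using assms(2)
proof (induction t arbitrary: v)
  case (Suc t)
  then obtain a b where "v = a + b" "a \<in> Poly_Mapping.keys p" "b \<in> Poly_Mapping.keys (p ^ t)"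
    using keys_mult[of p "p ^ t"] by auto
  then show ?case using assms(1)[of a] Suc.IH[of b] by simp
qed simp

lemma keys_prod_total_deg_le:
  fixes f :: "'i \<Rightarrow> ('n::finite, 'k::field) mpoly"
  assumes "\<And>i v. i \<in> A \<Longrightarrow> v \<in> Poly_Mapping.keys (f i) \<Longrightarrow> total_deg v \<le> D"
    "v \<in> Poly_Mapping.keys (prod f A)"
  shows "total_deg v \<le> card A * D"
  using assms
proof (induction A arbitrary: v rule: infinite_finite_induct)
  case (insert i A)
  then obtain a b where "v = a + b" "a \<in> Poly_Mapping.keys (f i)" "b \<in> Poly_Mapping.keys (prod f A)"
    using keys_mult[of "f i" "prod f A"] by auto
  then show ?case using insert.prems(1)[of i a] insert.IH[of b] insert by fastforce
qed simp_all

text \<open>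
  The bound holds for every subalgebra, finitely generated or not, because it rests only on
  counting: a chain of length \<open>n + 1\<close> would give \<open>n + 1\<close> algebraically independent polynomials.
\<close>

theorem krull_dim_subalgebra_le:
  fixes A :: "('n::finite, 'k::field) mpoly set"
  assumes const: "\<And>c. Poly_Mapping.single 0 c \<in> A"
  shows "krull_dim (mpoly_ring\<lparr>carrier := A\<rparr>) \<le> enat CARD('n)"
  unfolding krull_dim_def
proof (intro SUP_least, clarsimp, rule ccontr)
  fix l P
  assume prime: "\<forall>i\<le>l. primeideal (P i) (mpoly_ring\<lparr>carrier := A\<rparr>)"
    and chain: "\<forall>i<l. P i \<subset> P (Suc i)" and "\<not> l \<le> CARD('n)"
  define m where "m = Suc CARD('n)"
  have "m \<le> l" using \<open>\<not> l \<le> CARD('n)\<close> by (simp add: m_def)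
  have "\<exists>x. x \<in> P (Suc i) - P i" if "i < m" for i
    using chain \<open>m \<le> l\<close> that by (meson less_le_trans psubset_imp_ex_mem)
  then obtain x where x: "\<And>i. i < m \<Longrightarrow> x i \<in> P (Suc i) - P i" by metis
  define D where "D = (\<Sum>i<m. \<Sum>v\<in>Poly_Mapping.keys (x i). total_deg v)"
  have D: "total_deg v \<le> D" if "i < m" "v \<in> Poly_Mapping.keys (x i)" for i v
  proof -
    have "total_deg v \<le> (\<Sum>v\<in>Poly_Mapping.keys (x i). total_deg v)"
      using that by (intro member_le_sum) auto
    also have "\<dots> \<le> D" unfolding D_def using that by (intro member_le_sum) auto
    finally show ?thesis .
  qed
  \<comment> \<open>The products of the \<open>x\<^sub>i\<close> with exponents at most \<open>N\<close> have degree at most \<open>m N D < C (N + 1)\<close>.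
    They number \<open>(N + 1)\<^sup>n\<^sup>+\<^sup>1\<close> and lie in a space of dimension at most \<open>C\<^sup>n (N + 1)\<^sup>n\<close>, which is
    smaller as soon as \<open>C\<^sup>n < N + 1\<close>.\<close>
  define C where "C = Suc (m * D)"
  define N where "N = C ^ CARD('n)"
  define E where "E = PiE {0..<m} (\<lambda>_. {..N})"
  define y where "y e = (\<Prod>i\<in>{0..<m}. x i ^ e i)" for e
  have finE: "finite E" unfolding E_def by (rule finite_PiE) auto
  have indep: "c e = 0"
    if "(\<Sum>e\<in>E. Poly_Mapping.single 0 (c e) * y e) = 0" "e \<in> E" for c e
  proof (rule prime_chain_algebraically_independent[of m P A x 0 c N e])
    show "(\<Sum>e\<in>PiE {0..<m} (\<lambda>_. {..N}). Poly_Mapping.single 0 (c e) * (\<Prod>i\<in>{0..<m}. x i ^ e i)) \<in> P 0"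
      using that(1) primeideal_subring_type_algebraD(2)[of "P 0" A] prime by (simp add: E_def y_def)
    show "P i \<subseteq> P (Suc i)" if "i < m" for i
      using chain \<open>m \<le> l\<close> that by (meson less_le_trans psubset_imp_subset)
  qed (use that(2) prime const x \<open>m \<le> l\<close> in \<open>auto simp: E_def\<close>)
  interpret V: vector_space "\<lambda>(c::'k) (p::('n,'k) mpoly). Poly_Mapping.single 0 c * p"
    by (rule vector_space_mpoly)
  have inj: "inj_on y E"
  proof (rule inj_onI, rule ccontr)
    fix e e' assume e: "e \<in> E" "e' \<in> E" "y e = y e'" "e \<noteq> e'"
    define c :: "(nat \<Rightarrow> nat) \<Rightarrow> 'k" where "c f = (if f = e then 1 else if f = e' then - 1 else 0)" for f
    have "(\<Sum>f\<in>E. Poly_Mapping.single 0 (c f) * y f) = (\<Sum>f\<in>{e, e'}. Poly_Mapping.single 0 (c f) * y f)"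
      using finE e by (intro sum.mono_neutral_right) (auto simp: c_def)
    also have "\<dots> = 0" using e by (simp add: c_def single_uminus)
    finally show False using indep[of c e] e by (simp add: c_def)
  qed
  have "V.independent (y ` E)"
  proof
    assume "V.dependent (y ` E)"
    then obtain u b where ub: "b \<in> E" "u (y b) \<noteq> 0"
      and "(\<Sum>v\<in>y ` E. Poly_Mapping.single 0 (u v) * v) = 0"
      using finE by (subst (asm) V.dependent_finite) auto
    then show False using indep[of "u \<circ> y" b] by (subst (asm) sum.reindex[OF inj]) simp
  qed
  moreover define M where "M = m * (N * D)"
  let ?V = "{v :: 'n \<Rightarrow>\<^sub>0 nat. total_deg v \<le> M}"
  have "y ` E \<subseteq> V.span (monomial ` ?V)"
  proof
    fix p assume "p \<in> y ` E"
    then obtain e where e: "e \<in> E" "p = y e" by auto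
    have deg_p: "total_deg v \<le> M" if "v \<in> Poly_Mapping.keys p" for v
    proof -
      have "total_deg v \<le> card {0..<m} * (N * D)"
      proof (rule keys_prod_total_deg_le)
        show "v \<in> Poly_Mapping.keys (\<Prod>i\<in>{0..<m}. x i ^ e i)" using that e by (simp add: y_def)
        fix i w assume "i \<in> {0..<m}" and "w \<in> Poly_Mapping.keys (x i ^ e i)"
        then have "total_deg w \<le> e i * D" using keys_power_total_deg_le D by (metis atLeastLessThan_iff)
        also have "\<dots> \<le> N * D" using e \<open>i \<in> {0..<m}\<close> by (auto simp: E_def)
        finally show "total_deg w \<le> N * D" .
      qed
      then show ?thesis by (simp add: M_def)
    qed
    have "p = (\<Sum>v\<in>Poly_Mapping.keys p. Poly_Mapping.single 0 (Poly_Mapping.lookup p v) * monomial v)"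
      using poly_mapping_eq_sum_single[of p] by (simp add: mult_single)
    also have "\<dots> \<in> V.span (monomial ` ?V)"
      using deg_p by (intro V.span_sum V.span_scale V.span_base) auto
    finally show "p \<in> V.span (monomial ` ?V)" .
  qed
  ultimately have "card (y ` E) \<le> card (monomial ` ?V :: ('n,'k) mpoly set)"
    using V.independent_span_bound[of "monomial ` ?V" "y ` E"] card_bounded_total_deg(1)[of M] by auto
  also have "\<dots> \<le> Suc M ^ CARD('n)"
    using card_bounded_total_deg[of M, where 'n='n] by (simp add: card_image inj_monomial)
  also have "\<dots> \<le> (C * Suc N) ^ CARD('n)"
    by (intro power_mono) (auto simp: M_def C_def)
  also have "\<dots> = N * Suc N ^ CARD('n)"
    by (simp only: N_def power_mult_distrib)
  also have "\<dots> < Suc N ^ m" by (simp add: m_def)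
  also have "\<dots> = card (y ` E)"
    unfolding card_image[OF inj] by (simp add: E_def card_PiE)
  finally show False by simp
qed

section \<open>The fiber cone of an ideal generated by forms of one degree\<close>

text \<open>
  Primes pull back along a ring homomorphism, and a surjection keeps the inclusions strict.
\<close>

lemma krull_dim_surj_le:
  assumes R: "cring R" and S: "cring S" and h: "h \<in> ring_hom R S" "h ` carrier R = carrier S"
  shows "krull_dim S \<le> krull_dim R"
  unfolding krull_dim_def
proof (rule SUP_least, clarsimp)
  fix l P assume prime: "\<forall>i\<le>l. primeideal (P i) S" and chain: "\<forall>i<l. P i \<subset> P (Suc i)"
  interpret ring_hom_ring R S h
    using R S h(1) by (intro ring_hom_ringI2) (auto simp: cring_def)
  define Q where "Q i = {r \<in> carrier R. h r \<in> P i}" for i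
  have "primeideal (Q i) R" if "i \<le> l" for i
    unfolding Q_def using primeideal_vimage[OF R] prime that by blast
  moreover have "Q i \<subset> Q (Suc i)" if "i < l" for i
  proof -
    obtain x where x: "x \<in> P (Suc i)" "x \<notin> P i" using chain \<open>i < l\<close> by blast
    have "ideal (P (Suc i)) S" using prime \<open>i < l\<close> by (simp add: primeideal_def)
    then have "x \<in> carrier S" using x(1) ideal.Icarr by metis
    then obtain r where "r \<in> carrier R" "h r = x" using h(2) by (metis imageE)
    then have "r \<in> Q (Suc i) - Q i" using x by (simp add: Q_def)
    moreover have "Q i \<subseteq> Q (Suc i)" using chain \<open>i < l\<close> by (auto simp: Q_def)
    ultimately show ?thesis by blast
  qed
  ultimately show "enat l \<le> (SUP l \<in> {l. \<exists>P. (\<forall>i\<le>l. primeideal (P i) R) \<and> (\<forall>i<l. P i \<subset> P (Suc i))}. enat l)"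
    by (intro SUP_upper) blast
qed

lemma krull_dim_ring_iso:
  assumes R: "cring R" and S: "cring S" and h: "h \<in> ring_iso R S"
  shows "krull_dim R = krull_dim S"
proof (rule antisym)
  have "ring R" using R by (simp add: cring_def)
  then have "inv_into (carrier R) h \<in> ring_iso S R" using h by (rule ring_iso_set_sym)
  then show "krull_dim R \<le> krull_dim S"
    using krull_dim_surj_le[OF S R] by (auto simp: ring_iso_def bij_betw_def)
  show "krull_dim S \<le> krull_dim R"
    using krull_dim_surj_le[OF R S] h by (auto simp: ring_iso_def bij_betw_def)
qed

lemma ideal_type_algebra_add:
  fixes a b :: "'a::comm_ring_1"
  assumes "ideal I ring_of_type_algebra" "a \<in> I" "b \<in> I"
  shows "a + b \<in> I"
  using assms by (simp add: ideal_type_algebra_iff)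

lemma coset_type_algebra_iff:
  fixes x y :: "'a::comm_ring_1"
  shows "y \<in> H +>\<^bsub>ring_of_type_algebra\<^esub> x \<longleftrightarrow> y - x \<in> H"
proof -
  have "y \<in> H +>\<^bsub>ring_of_type_algebra\<^esub> x \<longleftrightarrow> (\<exists>h\<in>H. y = h + x)"
    by (auto simp: a_r_coset_def')
  also have "\<dots> \<longleftrightarrow> y - x \<in> H"
    by (metis add_diff_cancel_right' diff_add_cancel)
  finally show ?thesis .
qed

lemma coset_type_algebra_eq_iff:
  fixes x y :: "'a::comm_ring_1"
  assumes "ideal H ring_of_type_algebra"
  shows "H +>\<^bsub>ring_of_type_algebra\<^esub> x = H +>\<^bsub>ring_of_type_algebra\<^esub> y \<longleftrightarrow> x - y \<in> H"
proof
  assume *: "H +>\<^bsub>ring_of_type_algebra\<^esub> x = H +>\<^bsub>ring_of_type_algebra\<^esub> y"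
  have "x \<in> H +>\<^bsub>ring_of_type_algebra\<^esub> x"
    using assms by (simp add: coset_type_algebra_iff ideal_type_algebra_iff)
  then show "x - y \<in> H" unfolding * by (simp add: coset_type_algebra_iff)
next
  assume xy: "x - y \<in> H"
  show "H +>\<^bsub>ring_of_type_algebra\<^esub> x = H +>\<^bsub>ring_of_type_algebra\<^esub> y"
  proof (rule Set.set_eqI)
    fix z
    have "(z - x) + (x - y) = z - y" "(z - y) - (x - y) = z - x" by simp_all
    then have "z - x \<in> H \<longleftrightarrow> z - y \<in> H"
      using xy ideal_type_algebra_minus[OF assms] ideal_type_algebra_add[OF assms] by metis
    then show "z \<in> H +>\<^bsub>ring_of_type_algebra\<^esub> x \<longleftrightarrow> z \<in> H +>\<^bsub>ring_of_type_algebra\<^esub> y"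
      by (simp add: coset_type_algebra_iff)
  qed
qed

lemma coset_type_algebra_add:
  fixes x y :: "'a::comm_ring_1"
  assumes "ideal H ring_of_type_algebra"
  shows "(H +>\<^bsub>ring_of_type_algebra\<^esub> x) <+>\<^bsub>ring_of_type_algebra\<^esub> (H +>\<^bsub>ring_of_type_algebra\<^esub> y) =
    H +>\<^bsub>ring_of_type_algebra\<^esub> (x + y)"
  using ideal.a_rcos_sum[OF assms, of x y] by simp

lemma finsum_type_algebra:
  fixes f :: "'b \<Rightarrow> 'a::comm_ring_1"
  assumes "finite A"
  shows "finsum ring_of_type_algebra f A = sum f A"
proof -
  interpret R: cring "ring_of_type_algebra :: 'a ring" by (rule cring_from_type_algebra)
  show ?thesis using assms by (induction A) (auto simp: R.finsum_insert)
qed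

lemma lookup_0_times:
  fixes p q :: "('n::finite, 'k::field) mpoly"
  shows "Poly_Mapping.lookup (p * q) 0 = Poly_Mapping.lookup p 0 * Poly_Mapping.lookup q 0"
proof -
  have c: "hom_comp 0 p = Poly_Mapping.single 0 (Poly_Mapping.lookup p 0)" for p :: "('n, 'k) mpoly"
    by (rule poly_mapping_eqI) (auto simp: lookup_part lookup_single when_def)
  have "hom_comp 0 (p * q) = hom_comp 0 p * hom_comp 0 q"
    using hom_comp_times[of 0 p q] by simp
  then have "Poly_Mapping.lookup (hom_comp 0 (p * q)) 0 = Poly_Mapping.lookup (hom_comp 0 p * hom_comp 0 q) 0"
    by (rule arg_cong)
  then show ?thesis unfolding c mult_single by simp
qed

lemma irrelevant_ideal_iff:
  fixes p :: "('n::finite, 'k::field) mpoly"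
  shows "p \<in> irrelevant_ideal \<longleftrightarrow> Poly_Mapping.lookup p 0 = 0"
proof
  have "ideal {p :: ('n, 'k) mpoly. Poly_Mapping.lookup p 0 = 0} mpoly_ring"
    by (auto simp: ideal_type_algebra_iff lookup_add lookup_0_times)
  moreover have "range (\<lambda>i. monomial (Poly_Mapping.single i 1)) \<subseteq> {p :: ('n, 'k) mpoly. Poly_Mapping.lookup p 0 = 0}"
    by (auto simp: lookup_single when_def poly_mapping_eq_iff fun_eq_iff split: if_splits)
  ultimately have "irrelevant_ideal \<subseteq> {p :: ('n, 'k) mpoly. Poly_Mapping.lookup p 0 = 0}"
    unfolding irrelevant_ideal_def by (rule genideal_type_algebra_least)
  then show "p \<in> irrelevant_ideal \<Longrightarrow> Poly_Mapping.lookup p 0 = 0" by auto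
next
  have ideal: "ideal (irrelevant_ideal :: ('n, 'k) mpoly set) mpoly_ring"
    unfolding irrelevant_ideal_def by (rule ideal_genideal_type_algebra)
  assume p: "Poly_Mapping.lookup p 0 = 0"
  have "(\<Sum>v\<in>Poly_Mapping.keys p. Poly_Mapping.single v (Poly_Mapping.lookup p v)) \<in> irrelevant_ideal"
  proof (rule ideal_type_algebra_sum[OF ideal])
    fix v assume "v \<in> Poly_Mapping.keys p"
    with p have "v \<noteq> 0" by (auto simp: in_keys_iff)
    then obtain i where i: "Poly_Mapping.lookup v i \<noteq> 0" by (metis lookup_zero poly_mapping_eqI)
    have "v = (v - Poly_Mapping.single i 1) + Poly_Mapping.single i 1"
      by (rule poly_mapping_eqI) (use i in \<open>auto simp: lookup_add lookup_minus lookup_single when_def\<close>)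
    then have "Poly_Mapping.single v (Poly_Mapping.lookup p v) =
        Poly_Mapping.single (v - Poly_Mapping.single i 1) (Poly_Mapping.lookup p v) *
        monomial (Poly_Mapping.single i 1)"
      by (simp add: mult_single)
    moreover have "monomial (Poly_Mapping.single i 1) \<in> (irrelevant_ideal :: ('n, 'k) mpoly set)"
      unfolding irrelevant_ideal_def by (rule subsetD[OF subset_genideal_type_algebra]) (rule rangeI)
    ultimately show "Poly_Mapping.single v (Poly_Mapping.lookup p v) \<in> irrelevant_ideal"
      using ideal by (simp add: ideal_type_algebra_iff)
  qed
  then show "p \<in> irrelevant_ideal" by (simp flip: poly_mapping_eq_sum_single)
qed

lemma hom_comp_times_lowest:
  fixes p q :: "('n::finite, 'k::field) mpoly"
  assumes "\<And>v. v \<in> Poly_Mapping.keys p \<Longrightarrow> e \<le> total_deg v"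
    and "\<And>v. v \<in> Poly_Mapping.keys q \<Longrightarrow> f \<le> total_deg v"
  shows "hom_comp (e + f) (p * q) = hom_comp e p * hom_comp f q"
proof (rule part_times)
  fix u w assume "u \<in> Poly_Mapping.keys p" "w \<in> Poly_Mapping.keys q"
  then have "e \<le> total_deg u" "f \<le> total_deg w" using assms by auto
  then show "u + w \<in> {v. total_deg v = e + f} \<longleftrightarrow> u \<in> {v. total_deg v = e} \<and> w \<in> {v. total_deg v = f}"
    by auto
qed

lemma hom_comp_times_multiples:
  fixes p q :: "('n::finite, 'k::field) mpoly"
  assumes "0 < d" and "\<And>v. v \<in> Poly_Mapping.keys p \<Longrightarrow> d dvd total_deg v"
  shows "hom_comp (j * d) (p * q) = (\<Sum>i\<le>j. hom_comp (i * d) p * hom_comp ((j - i) * d) q)"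
proof -
  have "hom_comp (j * d) (p * q) = (\<Sum>m\<le>j * d. hom_comp m p * hom_comp (j * d - m) q)"
    by (rule hom_comp_times)
  also have "\<dots> = (\<Sum>m\<in>(\<lambda>i. i * d) ` {..j}. hom_comp m p * hom_comp (j * d - m) q)"
  proof (rule sum.mono_neutral_right)
    show "\<forall>m\<in>{..j * d} - (\<lambda>i. i * d) ` {..j}. hom_comp m p * hom_comp (j * d - m) q = 0"
    proof
      fix m assume m: "m \<in> {..j * d} - (\<lambda>i. i * d) ` {..j}"
      have "\<not> d dvd m"
      proof
        assume "d dvd m"
        then obtain i where "m = i * d" by (metis dvdE mult.commute)
        with m \<open>0 < d\<close> show False by auto
      qed
      then have "hom_comp m p = 0" using assms(2) by (auto simp: part_eq_0_iff)
      then show "hom_comp m p * hom_comp (j * d - m) q = 0" by simp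
    qed
  qed auto
  also have "\<dots> = (\<Sum>i\<le>j. hom_comp (i * d) p * hom_comp ((j - i) * d) q)"
    using \<open>0 < d\<close> by (subst sum.reindex) (auto simp: inj_on_def diff_mult_distrib)
  finally show ?thesis .
qed

lemma part_uminus: "part F (- p) = - part F (p :: 'a \<Rightarrow>\<^sub>0 'b::ab_group_add)"
  by (rule poly_mapping_eqI) (simp add: lookup_part when_def)

locale equigenerated =
  fixes G :: "('n::finite, 'k::field) mpoly set" and d :: nat and I
  assumes d: "0 < d" and homogeneous: "\<And>g. g \<in> G \<Longrightarrow> hom_comp d g = g"
  defines "I \<equiv> Idl\<^bsub>mpoly_ring\<^esub> G"
begin

definition mI :: "nat \<Rightarrow> ('n, 'k) mpoly set" where
  "mI j = irrelevant_ideal \<cdot>\<^bsub>mpoly_ring\<^esub> ideal_power I j"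

sublocale R: cring "mpoly_ring :: ('n, 'k) mpoly ring"
  by (rule cring_from_type_algebra)

lemma ideal_I: "ideal I mpoly_ring"
  unfolding I_def by (rule ideal_genideal_type_algebra)

lemma ideal_m: "ideal (irrelevant_ideal :: ('n, 'k) mpoly set) mpoly_ring"
  unfolding irrelevant_ideal_def by (rule ideal_genideal_type_algebra)

lemmas ideal_pow = ideal_ideal_power[OF ideal_I]

lemma ideal_mI: "ideal (mI j) mpoly_ring"
  unfolding mI_def by (intro R.ideal_prod_is_ideal ideal_m ideal_pow)

lemma mI_subset: "mI j \<subseteq> ideal_power I j"
  unfolding mI_def using R.ideal_prod_inter[OF ideal_m ideal_pow] by blast

lemma ideal_power_mult:
  assumes "a \<in> ideal_power I i" "b \<in> ideal_power I j"
  shows "a * b \<in> ideal_power I (i + j)"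
proof -
  interpret M: comm_monoid "ideals_set (mpoly_ring :: ('n, 'k) mpoly ring)"
    by (rule R.ideals_set_is_comm_monoid)
  have "ideal_power I (i + j) = ideal_power I i \<cdot>\<^bsub>mpoly_ring\<^esub> ideal_power I j"
    using M.nat_pow_mult[of I i j] ideal_I by (simp add: ideal_power_def ideals_set_def)
  then show ?thesis
    using ideal_prod.prod[OF assms, of mpoly_ring] by simp
qed

lemma I_keys: "a \<in> I \<Longrightarrow> v \<in> Poly_Mapping.keys a \<Longrightarrow> d \<le> total_deg v"
proof -
  have "ideal {a :: ('n,'k) mpoly. \<forall>v\<in>Poly_Mapping.keys a. d \<le> total_deg v} mpoly_ring"
    unfolding ideal_type_algebra_iff
  proof (intro conjI allI ballI)
    fix a b :: "('n,'k) mpoly"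
    assume "a \<in> {a. \<forall>v\<in>Poly_Mapping.keys a. d \<le> total_deg v}" "b \<in> {a. \<forall>v\<in>Poly_Mapping.keys a. d \<le> total_deg v}"
    then show "a + b \<in> {a. \<forall>v\<in>Poly_Mapping.keys a. d \<le> total_deg v}"
      using keys_add[of a b] by auto
  qed (auto intro: keys_times_total_deg_ge)
  moreover have "G \<subseteq> {a. \<forall>v\<in>Poly_Mapping.keys a. d \<le> total_deg v}"
    using homogeneous by (auto simp: part_eq_self_iff)
  ultimately have "I \<subseteq> {a. \<forall>v\<in>Poly_Mapping.keys a. d \<le> total_deg v}"
    unfolding I_def by (rule genideal_type_algebra_least)
  then show "a \<in> I \<Longrightarrow> v \<in> Poly_Mapping.keys a \<Longrightarrow> d \<le> total_deg v" by auto
qed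

lemma ideal_power_keys:
  "a \<in> ideal_power I j \<Longrightarrow> v \<in> Poly_Mapping.keys a \<Longrightarrow> j * d \<le> total_deg v"
proof (induction j arbitrary: a v)
  case (Suc j)
  from Suc.prems(1) have "a \<in> ideal_power I j \<cdot>\<^bsub>mpoly_ring\<^esub> I" by (simp add: ideal_power_Suc)
  then show ?case using Suc.prems(2)
  proof (induction arbitrary: v rule: ideal_prod.induct)
    case (prod a b)
    then obtain u w where "v = u + w" "u \<in> Poly_Mapping.keys a" "w \<in> Poly_Mapping.keys b"
      using keys_mult[of a b] by auto
    then show ?case using Suc.IH[of a u] I_keys[of b w] prod by simp
  next
    case (sum a b)
    then show ?case using keys_add[of a b] by auto
  qed
qed simp

text \<open>
  In \<open>s b - s\<^sub>0 b\<^sub>d = s (b - b\<^sub>d) + (s - s\<^sub>0) b\<^sub>d\<close>, where \<open>s\<^sub>0\<close> is the constant term of \<open>s\<close> and \<open>b\<^sub>d\<close> the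
  component of \<open>b\<close> of degree \<open>d\<close>, the second factor \<open>s - s\<^sub>0\<close> lies in the irrelevant ideal.  So the
  property holds for all multiples of the generators once it holds for the generators.
\<close>

lemma minus_hom_comp_in_mI_1:
  assumes "b \<in> I"
  shows "b - hom_comp d b \<in> irrelevant_ideal \<cdot>\<^bsub>mpoly_ring\<^esub> I"
proof -
  let ?MI = "irrelevant_ideal \<cdot>\<^bsub>mpoly_ring\<^esub> I"
  have MI: "ideal ?MI mpoly_ring" by (intro R.ideal_prod_is_ideal ideal_m ideal_I)
  have MI_I: "?MI \<subseteq> I" using R.ideal_prod_inter[OF ideal_m ideal_I] by blast
  define J where "J = {b \<in> I. b - hom_comp d b \<in> ?MI}"
  have "ideal J mpoly_ring"
    unfolding ideal_type_algebra_iff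
  proof (intro conjI allI ballI)
    show "0 \<in> J" using ideal_I MI by (simp add: J_def ideal_type_algebra_iff)
  next
    fix a b assume ab: "a \<in> J" "b \<in> J"
    have "(a - hom_comp d a) + (b - hom_comp d b) \<in> ?MI"
      using ab by (intro ideal_type_algebra_add[OF MI]) (auto simp: J_def)
    also have "(a - hom_comp d a) + (b - hom_comp d b) = a + b - hom_comp d (a + b)"
      by (simp add: part_add)
    finally show "a + b \<in> J" using ab ideal_type_algebra_add[OF ideal_I] by (simp add: J_def)
  next
    fix s b :: "('n, 'k) mpoly" assume b: "b \<in> J"
    let ?s0 = "Poly_Mapping.single 0 (Poly_Mapping.lookup s 0)"
    have "b - (b - hom_comp d b) \<in> I"
      by (rule ideal_type_algebra_minus[OF ideal_I]) (use b MI_I in \<open>auto simp: J_def\<close>)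
    then have "hom_comp d b \<in> I" by simp
    moreover have "s - ?s0 \<in> irrelevant_ideal"
      by (simp add: irrelevant_ideal_iff lookup_minus)
    ultimately have "(s - ?s0) * hom_comp d b \<in> ?MI"
      using ideal_prod.prod[of "s - ?s0" irrelevant_ideal "hom_comp d b" I mpoly_ring] by simp
    moreover have "hom_comp d (s * b) = ?s0 * hom_comp d b"
      using b I_keys by (intro hom_comp_times_const) (auto simp: J_def)
    then have "s * b - hom_comp d (s * b) = s * (b - hom_comp d b) + (s - ?s0) * hom_comp d b"
      by (simp add: algebra_simps)
    ultimately show "s * b \<in> J" using b MI ideal_I by (simp add: J_def ideal_type_algebra_iff)
  qed
  moreover have "G \<subseteq> J"
    using homogeneous subset_genideal_type_algebra[of G] MI by (auto simp: J_def I_def ideal_type_algebra_iff)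
  ultimately have "I \<subseteq> J" unfolding I_def by (rule genideal_type_algebra_least)
  then show ?thesis using assms by (auto simp: J_def)
qed

lemma mI_Suc:
  shows "mI (Suc j) = mI j \<cdot>\<^bsub>mpoly_ring\<^esub> I"
    and "mI (Suc j) = ideal_power I j \<cdot>\<^bsub>mpoly_ring\<^esub> (irrelevant_ideal \<cdot>\<^bsub>mpoly_ring\<^esub> I)"
proof -
  show 1: "mI (Suc j) = mI j \<cdot>\<^bsub>mpoly_ring\<^esub> I"
    unfolding mI_def ideal_power_Suc by (rule R.ideal_prod_assoc[OF ideal_m ideal_pow ideal_I, symmetric])
  show "mI (Suc j) = ideal_power I j \<cdot>\<^bsub>mpoly_ring\<^esub> (irrelevant_ideal \<cdot>\<^bsub>mpoly_ring\<^esub> I)"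
  proof -
    have "mI j = ideal_power I j \<cdot>\<^bsub>mpoly_ring\<^esub> irrelevant_ideal"
      unfolding mI_def by (rule R.ideal_prod_commute[OF ideal_m ideal_pow])
    then show ?thesis
      unfolding 1 by (simp add: R.ideal_prod_assoc[OF ideal_pow ideal_m ideal_I])
  qed
qed

text \<open>
  Together with \<open>hom_comp_mI\<close> below this identifies \<open>I\<^sup>j / \<mm> I\<^sup>j\<close> with the forms of degree \<open>j d\<close> in
  \<open>I\<^sup>j\<close>.  The step from \<open>j\<close> to \<open>j + 1\<close> is
  \<open>a b - a\<^sub>j\<^sub>d b\<^sub>d = (a - a\<^sub>j\<^sub>d) b + a\<^sub>j\<^sub>d (b - b\<^sub>d)\<close>.
\<close>

lemma minus_hom_comp_in_mI:
  "a \<in> ideal_power I j \<Longrightarrow> a - hom_comp (j * d) a \<in> mI j"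
proof (induction j arbitrary: a)
  case 0
  have "hom_comp 0 a = Poly_Mapping.single 0 (Poly_Mapping.lookup a 0)"
    by (rule poly_mapping_eqI) (auto simp: lookup_part lookup_single when_def)
  then have "a - hom_comp 0 a \<in> irrelevant_ideal"
    by (simp add: irrelevant_ideal_iff lookup_minus)
  then show ?case
    using ideal_prod.prod[of "a - hom_comp 0 a" irrelevant_ideal 1 UNIV mpoly_ring]
    by (simp add: mI_def ideal_power_0)
next
  case (Suc j)
  from Suc.prems have "a \<in> ideal_power I j \<cdot>\<^bsub>mpoly_ring\<^esub> I" by (simp add: ideal_power_Suc)
  then show ?case
  proof (induction rule: ideal_prod.induct)
    case (prod a b)
    have "hom_comp (j * d + d) (a * b) = hom_comp (j * d) a * hom_comp d b"
      by (rule hom_comp_times_lowest[OF ideal_power_keys[OF prod(1)] I_keys[OF prod(2)]])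
    then have *: "a * b - hom_comp (Suc j * d) (a * b) =
      (a - hom_comp (j * d) a) * b + hom_comp (j * d) a * (b - hom_comp d b)"
      by (simp add: algebra_simps)
    have "a - hom_comp (j * d) a \<in> ideal_power I j"
      using Suc.IH[of a] prod mI_subset by auto
    then have "a - (a - hom_comp (j * d) a) \<in> ideal_power I j"
      by (rule ideal_type_algebra_minus[OF ideal_pow prod(1)])
    then have 2: "hom_comp (j * d) a * (b - hom_comp d b) \<in> mI (Suc j)"
      unfolding mI_Suc(2)
      using ideal_prod.prod[of "hom_comp (j * d) a" "ideal_power I j" "b - hom_comp d b"
          "irrelevant_ideal \<cdot>\<^bsub>mpoly_ring\<^esub> I" mpoly_ring] minus_hom_comp_in_mI_1[of b] prod by simp
    have "(a - hom_comp (j * d) a) * b \<in> mI (Suc j)"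
      unfolding mI_Suc(1)
      using ideal_prod.prod[of "a - hom_comp (j * d) a" "mI j" b I mpoly_ring] Suc.IH[of a] prod by simp
    then show ?case using 2 unfolding type_algebra_simps * by (rule ideal_type_algebra_add[OF ideal_mI])
  next
    case (sum a b)
    have "(a - hom_comp (Suc j * d) a) + (b - hom_comp (Suc j * d) b) \<in> mI (Suc j)"
      using sum.IH by (intro ideal_type_algebra_add[OF ideal_mI])
    also have "(a - hom_comp (Suc j * d) a) + (b - hom_comp (Suc j * d) b) = a + b - hom_comp (Suc j * d) (a + b)"
      by (simp only: part_add) simp
    finally show ?case by simp
  qed
qed

lemma hom_comp_in_ideal_power:
  assumes "a \<in> ideal_power I j" shows "hom_comp (j * d) a \<in> ideal_power I j"
proof -
  have "a - hom_comp (j * d) a \<in> ideal_power I j"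
    using minus_hom_comp_in_mI[OF assms] mI_subset by auto
  then have "a - (a - hom_comp (j * d) a) \<in> ideal_power I j"
    by (rule ideal_type_algebra_minus[OF ideal_pow assms])
  then show ?thesis by simp
qed

lemma hom_comp_mI:
  assumes "a \<in> mI j" shows "hom_comp (j * d) a = 0"
proof -
  from assms have "a \<in> irrelevant_ideal \<cdot>\<^bsub>mpoly_ring\<^esub> ideal_power I j" by (simp only: mI_def)
  then show ?thesis
  proof (induction rule: ideal_prod.induct)
    case (prod m a)
    have "hom_comp (j * d) (m * a) = Poly_Mapping.single 0 (Poly_Mapping.lookup m 0) * hom_comp (j * d) a"
      using ideal_power_keys[OF prod(2)] by (rule hom_comp_times_const)
    then show ?case using prod(1) by (simp add: irrelevant_ideal_iff)
  next
    case (sum a b)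
    then show ?case by (simp add: part_add)
  qed
qed

text \<open>
  The subalgebra of the polynomial ring spanned by the forms of degree \<open>j d\<close> in \<open>I\<^sup>j\<close>.  For a
  monomial ideal it is the toric ring generated by the monomials in question.
\<close>

definition form_algebra :: "('n, 'k) mpoly set" where
  "form_algebra = {p. (\<forall>v\<in>Poly_Mapping.keys p. d dvd total_deg v) \<and>
     (\<forall>j. hom_comp (j * d) p \<in> ideal_power I j)}"

lemma const_in_form_algebra: "Poly_Mapping.single 0 c \<in> form_algebra"
proof -
  have "hom_comp (j * d) (Poly_Mapping.single 0 c) \<in> ideal_power I j" for j
  proof (cases "j = 0")
    case False
    then have "hom_comp (j * d) (Poly_Mapping.single 0 c) = (0 :: ('n, 'k) mpoly)"
      using d by (simp add: part_single when_def)
    then show ?thesis using ideal_pow by (simp add: ideal_type_algebra_iff)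
  qed (simp add: ideal_power_0)
  then show ?thesis by (simp add: form_algebra_def)
qed

lemma cring_form_algebra: "cring (mpoly_ring\<lparr>carrier := form_algebra\<rparr>)"
  unfolding cring_subring_type_algebra_iff
proof (intro conjI ballI)
  show "0 \<in> form_algebra" "1 \<in> form_algebra"
    using const_in_form_algebra[of 0] const_in_form_algebra[of 1] by simp_all
next
  fix p assume p: "p \<in> form_algebra"
  have "- hom_comp (j * d) p \<in> ideal_power I j" for j
    using p ideal_type_algebra_minus[OF ideal_pow, of 0 j "hom_comp (j * d) p"] ideal_pow
    by (simp add: form_algebra_def ideal_type_algebra_iff)
  then show "- p \<in> form_algebra"
    using p by (simp add: form_algebra_def part_uminus)
next
  fix p q assume pq: "p \<in> form_algebra" "q \<in> form_algebra"
  show "p + q \<in> form_algebra"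
    using pq keys_add[of p q] ideal_pow by (auto simp: form_algebra_def part_add ideal_type_algebra_iff)
  have "hom_comp (j * d) (p * q) \<in> ideal_power I j" for j
  proof -
    have "hom_comp (j * d) (p * q) = (\<Sum>i\<le>j. hom_comp (i * d) p * hom_comp ((j - i) * d) q)"
      using d pq by (intro hom_comp_times_multiples) (auto simp: form_algebra_def)
    also have "\<dots> \<in> ideal_power I j"
    proof (rule ideal_type_algebra_sum[OF ideal_pow])
      fix i assume "i \<in> {..j}"
      then show "hom_comp (i * d) p * hom_comp ((j - i) * d) q \<in> ideal_power I j"
        using ideal_power_mult[of "hom_comp (i * d) p" i "hom_comp ((j - i) * d) q" "j - i"] pq
        by (simp add: form_algebra_def)
    qed
    finally show ?thesis .
  qed
  moreover have "d dvd total_deg v" if "v \<in> Poly_Mapping.keys (p * q)" for v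
    using that keys_mult[of p q] pq by (fastforce simp: form_algebra_def)
  ultimately show "p * q \<in> form_algebra" by (simp add: form_algebra_def)
qed

definition to_fiber_cone :: "('n, 'k) mpoly \<Rightarrow> nat \<Rightarrow> ('n, 'k) mpoly set" where
  "to_fiber_cone p j = mI j +>\<^bsub>mpoly_ring\<^esub> hom_comp (j * d) p"

abbreviation F where "F \<equiv> fiber_cone mpoly_ring irrelevant_ideal I"

lemma fiber_cone_simps:
  "carrier F = {f. (\<forall>j. f j \<in> (\<lambda>x. mI j +>\<^bsub>mpoly_ring\<^esub> x) ` ideal_power I j) \<and> finite {j. f j \<noteq> mI j}}"
  "f \<otimes>\<^bsub>F\<^esub> g = (\<lambda>j. \<Union>a \<in> Pi UNIV f. \<Union>b \<in> Pi UNIV g.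
     mI j +>\<^bsub>mpoly_ring\<^esub> (\<Sum>i\<le>j. a i * b (j - i)))"
  "\<one>\<^bsub>F\<^esub> = (\<lambda>j. if j = 0 then mI 0 +>\<^bsub>mpoly_ring\<^esub> 1 else mI j)"
  "\<zero>\<^bsub>F\<^esub> = mI"
  "f \<oplus>\<^bsub>F\<^esub> g = (\<lambda>j. f j <+>\<^bsub>mpoly_ring\<^esub> g j)"
  by (simp_all add: fiber_cone_def Let_def finsum_type_algebra cong: if_cong flip: ideal_power_def mI_def)

lemma mI_coset_0: "mI j +>\<^bsub>mpoly_ring\<^esub> 0 = mI j"
  using coset_type_algebra_iff[of _ "mI j" 0] by auto

lemma mI_coset_hom_comp:
  assumes "a \<in> ideal_power I j"
  shows "mI j +>\<^bsub>mpoly_ring\<^esub> hom_comp (j * d) a = mI j +>\<^bsub>mpoly_ring\<^esub> a"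
proof -
  have "- (a - hom_comp (j * d) a) \<in> mI j"
    using minus_hom_comp_in_mI[OF assms] ideal_type_algebra_minus[OF ideal_mI, of 0 j] ideal_mI
    by (metis diff_0 ideal_type_algebra_iff)
  then show ?thesis by (simp add: coset_type_algebra_eq_iff[OF ideal_mI])
qed

text \<open>
  The product in the fiber cone is a union over all representatives; each of them yields the same
  coset, because representatives of a coset in \<open>I\<^sup>i\<close> share their component of degree \<open>i d\<close>.
\<close>

lemma to_fiber_cone_mult:
  assumes p: "p \<in> form_algebra" and q: "q \<in> form_algebra"
  shows "to_fiber_cone (p * q) = to_fiber_cone p \<otimes>\<^bsub>F\<^esub> to_fiber_cone q"
proof
  fix j
  have rep: "a i \<in> ideal_power I i \<and> hom_comp (i * d) (a i) = hom_comp (i * d) p"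
    if a: "a \<in> Pi UNIV (to_fiber_cone p)" and p: "p \<in> form_algebra" for a p i
  proof -
    have "a i \<in> to_fiber_cone p i" using a by auto
    then have *: "a i - hom_comp (i * d) p \<in> mI i"
      by (simp add: to_fiber_cone_def coset_type_algebra_iff)
    have "hom_comp (i * d) p \<in> ideal_power I i" using p by (simp add: form_algebra_def)
    then have "(a i - hom_comp (i * d) p) + hom_comp (i * d) p \<in> ideal_power I i"
      using * mI_subset by (intro ideal_type_algebra_add[OF ideal_pow]) auto
    moreover have "hom_comp (i * d) (a i - hom_comp (i * d) p) = 0"
      using * by (rule hom_comp_mI)
    ultimately show ?thesis by (simp add: part_minus)
  qed
  have "mI j +>\<^bsub>mpoly_ring\<^esub> (\<Sum>i\<le>j. a i * b (j - i)) = to_fiber_cone (p * q) j"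
    if a: "a \<in> Pi UNIV (to_fiber_cone p)" and b: "b \<in> Pi UNIV (to_fiber_cone q)" for a b
  proof -
    have in_pow: "a i * b (j - i) \<in> ideal_power I j" if "i \<le> j" for i
      using ideal_power_mult[of "a i" i "b (j - i)" "j - i"] rep[OF a p] rep[OF b q] that by simp
    have "hom_comp (j * d) (a i * b (j - i)) = hom_comp (i * d) p * hom_comp ((j - i) * d) q" if "i \<le> j" for i
    proof -
      have "hom_comp (i * d + (j - i) * d) (a i * b (j - i)) = hom_comp (i * d) (a i) * hom_comp ((j - i) * d) (b (j - i))"
        using rep[OF a p] rep[OF b q] ideal_power_keys by (intro hom_comp_times_lowest) blast+
      moreover have "i * d + (j - i) * d = j * d" using that by (simp flip: add_mult_distrib)
      ultimately show ?thesis using rep[OF a p] rep[OF b q] by simp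
    qed
    then have "hom_comp (j * d) (\<Sum>i\<le>j. a i * b (j - i)) = (\<Sum>i\<le>j. hom_comp (i * d) p * hom_comp ((j - i) * d) q)"
      by (simp add: part_sum)
    also have "\<dots> = hom_comp (j * d) (p * q)"
      using d p by (intro hom_comp_times_multiples[symmetric]) (auto simp: form_algebra_def)
    finally have "hom_comp (j * d) (\<Sum>i\<le>j. a i * b (j - i)) = hom_comp (j * d) (p * q)" .
    moreover have "(\<Sum>i\<le>j. a i * b (j - i)) \<in> ideal_power I j"
      using in_pow by (intro ideal_type_algebra_sum[OF ideal_pow]) auto
    ultimately show ?thesis
      using mI_coset_hom_comp[of "\<Sum>i\<le>j. a i * b (j - i)" j] by (simp only: to_fiber_cone_def)
  qed
  moreover have "Pi UNIV (to_fiber_cone p) \<noteq> {}" for p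
  proof -
    have "(\<lambda>j. hom_comp (j * d) p) \<in> Pi UNIV (to_fiber_cone p)"
      using ideal_mI by (auto simp: to_fiber_cone_def coset_type_algebra_iff ideal_type_algebra_iff)
    then show ?thesis by (rule ex_in_conv[THEN iffD1, OF exI])
  qed
  ultimately show "to_fiber_cone (p * q) j = (to_fiber_cone p \<otimes>\<^bsub>F\<^esub> to_fiber_cone q) j"
    by (simp add: fiber_cone_simps)
qed

lemma form_algebra_eqI:
  assumes "p \<in> form_algebra" "q \<in> form_algebra"
    and "\<And>j. hom_comp (j * d) p = hom_comp (j * d) q"
  shows "p = q"
proof (rule poly_mapping_eqI)
  fix v
  show "Poly_Mapping.lookup p v = Poly_Mapping.lookup q v"
  proof (cases "d dvd total_deg v")
    case True
    then obtain j where "total_deg v = j * d" by (metis dvdE mult.commute)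
    then show ?thesis using arg_cong[OF assms(3)[of j], of "\<lambda>p. Poly_Mapping.lookup p v"]
      by (simp add: lookup_part)
  next
    case False
    then have "v \<notin> Poly_Mapping.keys p" "v \<notin> Poly_Mapping.keys q"
      using assms by (auto simp: form_algebra_def)
    then show ?thesis by (simp add: in_keys_iff)
  qed
qed

lemma to_fiber_cone_iso: "to_fiber_cone \<in> ring_iso (mpoly_ring\<lparr>carrier := form_algebra\<rparr>) F"
proof (rule ring_iso_memI)
  have closed: "to_fiber_cone p \<in> carrier F" if p: "p \<in> form_algebra" for p
  proof -
    have "{j. to_fiber_cone p j \<noteq> mI j} \<subseteq> (\<lambda>j. j * d) -` (total_deg ` Poly_Mapping.keys p)"
    proof
      fix j assume "j \<in> {j. to_fiber_cone p j \<noteq> mI j}"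
      then have "hom_comp (j * d) p \<noteq> 0" using mI_coset_0 by (auto simp: to_fiber_cone_def)
      then show "j \<in> (\<lambda>j. j * d) -` (total_deg ` Poly_Mapping.keys p)"
        by (auto simp: part_eq_0_iff image_iff) metis
    qed
    moreover have "finite ((\<lambda>j. j * d) -` (total_deg ` Poly_Mapping.keys p))"
      using d by (intro finite_vimageI) (auto simp: inj_on_def)
    ultimately have "finite {j. to_fiber_cone p j \<noteq> mI j}" by (rule finite_subset)
    then show ?thesis using p by (auto simp: fiber_cone_simps to_fiber_cone_def form_algebra_def)
  qed
  then show "\<And>p. p \<in> carrier (mpoly_ring\<lparr>carrier := form_algebra\<rparr>) \<Longrightarrow> to_fiber_cone p \<in> carrier F"
    by simp
  show "to_fiber_cone (p \<otimes>\<^bsub>mpoly_ring\<lparr>carrier := form_algebra\<rparr>\<^esub> q) = to_fiber_cone p \<otimes>\<^bsub>F\<^esub> to_fiber_cone q"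
    if "p \<in> carrier (mpoly_ring\<lparr>carrier := form_algebra\<rparr>)" "q \<in> carrier (mpoly_ring\<lparr>carrier := form_algebra\<rparr>)" for p q
    using to_fiber_cone_mult that by simp
  show "to_fiber_cone (p \<oplus>\<^bsub>mpoly_ring\<lparr>carrier := form_algebra\<rparr>\<^esub> q) = to_fiber_cone p \<oplus>\<^bsub>F\<^esub> to_fiber_cone q" for p q
    by (simp add: fiber_cone_simps to_fiber_cone_def fun_eq_iff part_add coset_type_algebra_add[OF ideal_mI])
  have "hom_comp m (1 :: ('n, 'k) mpoly) = (if m = 0 then 1 else 0)" for m
    by (simp add: part_single when_def flip: single_one)
  then show "to_fiber_cone \<one>\<^bsub>mpoly_ring\<lparr>carrier := form_algebra\<rparr>\<^esub> = \<one>\<^bsub>F\<^esub>"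
    using d by (auto simp: fiber_cone_simps to_fiber_cone_def fun_eq_iff mI_coset_0)
  have inj: "inj_on to_fiber_cone form_algebra"
  proof (rule inj_onI)
    fix p q assume pq: "p \<in> form_algebra" "q \<in> form_algebra" "to_fiber_cone p = to_fiber_cone q"
    show "p = q"
    proof (rule form_algebra_eqI[OF pq(1,2)])
      fix j
      have "to_fiber_cone p j = to_fiber_cone q j" using pq(3) by simp
      then have "hom_comp (j * d) p - hom_comp (j * d) q \<in> mI j"
        by (simp add: to_fiber_cone_def coset_type_algebra_eq_iff[OF ideal_mI])
      then have "hom_comp (j * d) (hom_comp (j * d) p - hom_comp (j * d) q) = 0"
        by (rule hom_comp_mI)
      then show "hom_comp (j * d) p = hom_comp (j * d) q" by (simp add: part_minus)
    qed
  qed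
  have surj: "f \<in> to_fiber_cone ` form_algebra" if f: "f \<in> carrier F" for f
  proof -
    have "\<forall>j. \<exists>x. x \<in> ideal_power I j \<and> f j = mI j +>\<^bsub>mpoly_ring\<^esub> x"
      using f by (auto simp: fiber_cone_simps)
    then obtain x where x: "\<And>j. x j \<in> ideal_power I j" "\<And>j. f j = mI j +>\<^bsub>mpoly_ring\<^esub> x j" by metis
    define S where "S = {j. f j \<noteq> mI j}"
    have "finite S" using f by (simp add: fiber_cone_simps S_def)
    define p where "p = (\<Sum>j\<in>S. hom_comp (j * d) (x j))"
    have hc: "hom_comp (i * d) p = (if i \<in> S then hom_comp (i * d) (x i) else 0)" for i
    proof -
      have "hom_comp (i * d) p = (\<Sum>j\<in>S. if i = j then hom_comp (j * d) (x j) else 0)"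
        unfolding p_def part_sum using d
        by (intro sum.cong refl) (auto simp: part_eq_0_iff)
      then show ?thesis using \<open>finite S\<close> by simp
    qed
    have "d dvd total_deg v" if "v \<in> Poly_Mapping.keys p" for v
      using that keys_sum[of "\<lambda>j. hom_comp (j * d) (x j)" S] unfolding p_def by fastforce
    then have "p \<in> form_algebra"
      using hc hom_comp_in_ideal_power x(1) ideal_pow by (auto simp: form_algebra_def ideal_type_algebra_iff)
    moreover have "f = to_fiber_cone p"
    proof
      fix i
      show "f i = to_fiber_cone p i"
        using mI_coset_hom_comp[OF x(1)[of i]] x(2)[of i] mI_coset_0
        by (auto simp: to_fiber_cone_def hc S_def)
    qed
    ultimately show ?thesis by blast
  qed
  show "bij_betw to_fiber_cone (carrier (mpoly_ring\<lparr>carrier := form_algebra\<rparr>)) (carrier F)"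
    using inj closed surj by (auto simp: bij_betw_def)
qed

lemma analytic_spread_eq: "analytic_spread I = krull_dim (mpoly_ring\<lparr>carrier := form_algebra\<rparr>)"
proof -
  interpret A: cring "mpoly_ring\<lparr>carrier := form_algebra\<rparr>" by (rule cring_form_algebra)
  have "to_fiber_cone \<zero>\<^bsub>mpoly_ring\<lparr>carrier := form_algebra\<rparr>\<^esub> = \<zero>\<^bsub>F\<^esub>"
    by (simp add: fiber_cone_simps to_fiber_cone_def fun_eq_iff mI_coset_0)
  then have "cring (F\<lparr>zero := \<zero>\<^bsub>F\<^esub>\<rparr>)"
    using A.ring_iso_imp_img_cring[OF to_fiber_cone_iso] by (simp only:)
  moreover have "F\<lparr>zero := \<zero>\<^bsub>F\<^esub>\<rparr> = F"
    by (rule ring.equality) simp_all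
  ultimately have "cring F" by (simp only:)
  then show ?thesis
    unfolding analytic_spread_def using krull_dim_ring_iso[OF cring_form_algebra _ to_fiber_cone_iso] by (simp only:)
qed

theorem analytic_spread_le: "analytic_spread I \<le> enat CARD('n)"
  unfolding analytic_spread_eq by (rule krull_dim_subalgebra_le) (rule const_in_form_algebra)

end

section \<open>The analytic spread of squarefree Veronese ideals\<close>

definition indicator_exponent :: "'n::finite set \<Rightarrow> ('n \<Rightarrow>\<^sub>0 nat)" where
  "indicator_exponent S = (\<Sum>i\<in>S. Poly_Mapping.single i 1)"

lemma lookup_indicator_exponent [simp]:
  "Poly_Mapping.lookup (indicator_exponent S) i = (if i \<in> S then 1 else 0)"
  unfolding indicator_exponent_def lookup_sum lookup_single when_def by simp

lemma total_deg_indicator_exponent [simp]: "total_deg (indicator_exponent S) = card S"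
  by (simp add: total_deg_def sum.If_cases)

lemma inj_indicator_exponent: "inj indicator_exponent"
proof (rule injI)
  fix S T :: "'a set" assume "indicator_exponent S = indicator_exponent T"
  then have "(if i \<in> S then 1 else (0 :: nat)) = (if i \<in> T then 1 else 0)" for i
    by (metis lookup_indicator_exponent)
  then show "S = T" by (auto split: if_splits) (metis zero_neq_one)+
qed

definition squarefree_exponents :: "nat \<Rightarrow> ('n::finite \<Rightarrow>\<^sub>0 nat) set" where
  "squarefree_exponents d = indicator_exponent ` {S. card S = d}"

lemma squarefree_exponents_iff:
  "b \<in> squarefree_exponents d \<longleftrightarrow> total_deg b = d \<and> (\<forall>i. Poly_Mapping.lookup b i \<le> 1)"
proof
  assume b: "total_deg b = d \<and> (\<forall>i. Poly_Mapping.lookup b i \<le> 1)"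
  then have "b = indicator_exponent {i. Poly_Mapping.lookup b i = 1}"
    by (intro poly_mapping_eqI) (auto, metis One_nat_def le_0_eq le_SucE)
  moreover from this b have "card {i. Poly_Mapping.lookup b i = 1} = d"
    by (metis total_deg_indicator_exponent)
  ultimately show "b \<in> squarefree_exponents d" unfolding squarefree_exponents_def by blast
qed (auto simp: squarefree_exponents_def)

lemma veronese_ideal_eq: "veronese_ideal 1 d = monomial_ideal (squarefree_exponents d)"
  unfolding veronese_ideal_def monomial_ideal_def
  by (rule arg_cong[of _ _ "genideal _"]) (auto simp: squarefree_exponents_iff simp flip: total_deg_def)

text \<open>
  For exponents in the cone \<open>0 \<le> d v\<^sub>i \<le> |v|\<close> the facets are \<open>v\<^sub>i = 0\<close> and \<open>d v\<^sub>i = |v|\<close>.  A complete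
  flag of faces arises by first imposing \<open>v\<^sub>i = 0\<close> for \<open>n - d - 1\<close> of the coordinates, which leaves
  the cone over a \<open>d\<close>-dimensional simplex with vertices \<open>1 - e\<^sub>i\<close>, and then imposing \<open>d v\<^sub>i = |v|\<close>
  for the remaining \<open>d + 1\<close> coordinates one after the other, down to the apex.  At each step some
  squarefree exponent of degree \<open>d\<close> lies on the old face but not on the new one, so the
  corresponding monomial primes strictly increase.
\<close>

theorem krull_dim_squarefree_algebra_ge:
  fixes A :: "('n::finite, 'k::field) mpoly set"
  assumes d: "0 < d" "d < CARD('n)"
    and A: "cring (mpoly_ring\<lparr>carrier := A\<rparr>)"
    and cone: "\<And>p v i. p \<in> A \<Longrightarrow> v \<in> Poly_Mapping.keys p \<Longrightarrow> d * Poly_Mapping.lookup v i \<le> total_deg v"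
    and gens: "\<And>b. b \<in> squarefree_exponents d \<Longrightarrow> monomial b \<in> A"
  shows "enat CARD('n) \<le> krull_dim (mpoly_ring\<lparr>carrier := A\<rparr>)"
proof -
  define n where "n = CARD('n)"
  define t where "t = n - d - 1"
  obtain \<sigma> :: "nat \<Rightarrow> 'n" where \<sigma>: "bij_betw \<sigma> {..<n} UNIV"
    using ex_bij_betw_nat_finite[of "UNIV :: 'n set"] by (auto simp: n_def atLeast0LessThan)
  have inj: "inj_on \<sigma> {..<n}" using \<sigma> by (simp add: bij_betw_def)
  have \<sigma>_eq: "\<sigma> k = \<sigma> k' \<longleftrightarrow> k = k'" if "k < n" "k' < n" for k k'
    using inj that by (auto simp: inj_on_def)
  define on_facet where "on_facet k v \<longleftrightarrow>
      (if k < t then Poly_Mapping.lookup v (\<sigma> k) = 0 else d * Poly_Mapping.lookup v (\<sigma> k) = total_deg v)" for k v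
  define face where "face m = {v. \<forall>k<m. on_facet k v}" for m
  define P where "P m = {p \<in> A. part (face m) p = 0}" for m
  have A_closed: "0 \<in> A" "1 \<in> A" "\<And>a b. a \<in> A \<Longrightarrow> b \<in> A \<Longrightarrow> a + b \<in> A" "\<And>a b. a \<in> A \<Longrightarrow> b \<in> A \<Longrightarrow> a * b \<in> A"
    using A by (simp_all add: cring_subring_type_algebra_iff)
  have part_face_times: "part (face m) (p * q) = part (face m) p * part (face m) q"
    if "p \<in> A" "q \<in> A" for m p q
  proof (rule part_times)
    fix u w assume uw: "u \<in> Poly_Mapping.keys p" "w \<in> Poly_Mapping.keys q"
    have "on_facet k (u + w) \<longleftrightarrow> on_facet k u \<and> on_facet k w" for k
      using cone[OF that(1) uw(1), of "\<sigma> k"] cone[OF that(2) uw(2), of "\<sigma> k"]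
      by (auto simp: on_facet_def lookup_add distrib_left)
    then show "u + w \<in> face m \<longleftrightarrow> u \<in> face m \<and> w \<in> face m" by (auto simp: face_def)
  qed
  have "primeideal (P m) (mpoly_ring\<lparr>carrier := A\<rparr>)" for m
  proof (rule primeidealI)
    show "ideal (P m) (mpoly_ring\<lparr>carrier := A\<rparr>)"
      using A_closed part_face_times by (intro ideal_subring_type_algebraI[OF A]) (auto simp: P_def part_add)
    have "0 \<in> face m" by (simp add: face_def on_facet_def)
    then have "part (face m) (1 :: ('n, 'k) mpoly) = 1"
      by (simp add: part_single when_def flip: single_one)
    then have "1 \<notin> P m" by (simp add: P_def)
    then show "carrier (mpoly_ring\<lparr>carrier := A\<rparr>) \<noteq> P m" using A_closed by auto
    show "p \<in> P m \<or> q \<in> P m" if "p \<in> carrier (mpoly_ring\<lparr>carrier := A\<rparr>)" "q \<in> carrier (mpoly_ring\<lparr>carrier := A\<rparr>)"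
      "p \<otimes>\<^bsub>mpoly_ring\<lparr>carrier := A\<rparr>\<^esub> q \<in> P m" for p q
      using that part_face_times[of p q m] mpoly_no_zero_divisors[of "part (face m) p" "part (face m) q"]
      by (auto simp: P_def)
  qed (rule A)
  moreover have "P m \<subset> P (Suc m)" if "m < n" for m
  proof -
    have "face (Suc m) \<subseteq> face m" by (auto simp: face_def)
    then have "P m \<subseteq> P (Suc m)" by (auto simp: P_def part_eq_0_iff)
    moreover obtain b where b: "b \<in> squarefree_exponents d" "b \<in> face m" "b \<notin> face (Suc m)"
    proof (cases "m < t")
      case True
      define S where "S = \<sigma> ` {m..<m + d}"
      have sub: "{m..<m + d} \<subseteq> {..<n}" using True by (auto simp: t_def)
      have S_iff: "\<sigma> k \<in> S \<longleftrightarrow> m \<le> k \<and> k < m + d" if "k < n" for k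
        using that sub \<sigma>_eq by (fastforce simp: S_def)
      have "card S = d"
        unfolding S_def using card_image[OF inj_on_subset[OF inj sub]] by simp
      moreover have "on_facet k (indicator_exponent S)" if "k < m" for k
        using that True \<open>m < n\<close> S_iff[of k] by (simp add: on_facet_def)
      moreover have "\<not> on_facet m (indicator_exponent S)"
        using True \<open>m < n\<close> S_iff[of m] d by (simp add: on_facet_def)
      ultimately show ?thesis
        using that[of "indicator_exponent S"] by (auto simp: face_def squarefree_exponents_def)
    next
      case False
      define S where "S = \<sigma> ` ({t..<n} - {m})"
      have sub: "{t..<n} - {m} \<subseteq> {..<n}" by auto
      have S_iff: "\<sigma> k \<in> S \<longleftrightarrow> t \<le> k \<and> k \<noteq> m" if "k < n" for k
        using that sub \<sigma>_eq by (fastforce simp: S_def)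
      have "card S = card ({t..<n} - {m})"
        unfolding S_def by (rule card_image[OF inj_on_subset[OF inj sub]])
      also have "\<dots> = d" using False \<open>m < n\<close> d by (simp add: t_def n_def)
      finally have "card S = d" .
      moreover have "on_facet k (indicator_exponent S)" if "k < m" for k
        using that \<open>card S = d\<close> \<open>m < n\<close> S_iff[of k] by (simp add: on_facet_def)
      moreover have "\<not> on_facet m (indicator_exponent S)"
        using False \<open>card S = d\<close> \<open>m < n\<close> S_iff[of m] d by (simp add: on_facet_def)
      ultimately show ?thesis
        using that[of "indicator_exponent S"] by (auto simp: face_def squarefree_exponents_def)
    qed
    then have "monomial b \<in> P (Suc m) - P m"
      using gens by (auto simp: P_def part_eq_0_iff)
    ultimately show ?thesis by blast
  qed
  ultimately show ?thesis
    unfolding krull_dim_def n_def by (intro SUP_upper) blast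
qed

lemma equigenerated_squarefree:
  assumes "0 < d"
  shows "equigenerated (monomial ` squarefree_exponents d :: ('n::finite, 'k::field) mpoly set) d"
  using assms by unfold_locales (auto simp: part_single squarefree_exponents_iff)

text \<open>
  A term of degree \<open>j d\<close> in an element of \<open>I\<^sup>j\<close> is a product of \<open>j\<close> terms of degree \<open>d\<close> in \<open>I\<close>, each
  of them squarefree.
\<close>

lemma squarefree_power_keys:
  fixes a :: "('n::finite, 'k::field) mpoly"
  assumes d: "0 < d"
    and "a \<in> ideal_power (monomial_ideal (squarefree_exponents d)) j"
    and "v \<in> Poly_Mapping.keys a" "total_deg v = j * d"
  shows "Poly_Mapping.lookup v i \<le> j"
proof -
  interpret equigenerated "monomial ` squarefree_exponents d :: ('n, 'k) mpoly set" d
      "monomial_ideal (squarefree_exponents d)"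
    by (rule equigenerated_squarefree[OF d]) (rule eq_reflection[OF monomial_ideal_def])
  let ?I = "monomial_ideal (squarefree_exponents d) :: ('n, 'k) mpoly set"
  have base: "Poly_Mapping.lookup v i \<le> 1" if "a \<in> ?I" "v \<in> Poly_Mapping.keys a" "total_deg v = d" for a v
  proof -
    define J where "J = {a :: ('n, 'k) mpoly. \<forall>v\<in>Poly_Mapping.keys a.
        d \<le> total_deg v \<and> (total_deg v = d \<longrightarrow> Poly_Mapping.lookup v i \<le> 1)}"
    have "ideal J mpoly_ring"
      unfolding ideal_type_algebra_iff
    proof (intro conjI allI ballI)
      show "0 \<in> J" by (simp add: J_def)
      show "a + b \<in> J" if "a \<in> J" "b \<in> J" for a b
        using that keys_add[of a b] by (auto simp: J_def)
      show "s * a \<in> J" if "a \<in> J" for s a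
        unfolding J_def
      proof (clarify, intro conjI impI)
        fix v assume "v \<in> Poly_Mapping.keys (s * a)"
        then obtain u w where v: "v = u + w" "w \<in> Poly_Mapping.keys a"
          using keys_mult[of s a] by auto
        with \<open>a \<in> J\<close> have w: "d \<le> total_deg w" "total_deg w = d \<Longrightarrow> Poly_Mapping.lookup w i \<le> 1"
          by (auto simp: J_def)
        then show "d \<le> total_deg v" using v by simp
        assume "total_deg v = d"
        then have "total_deg u = 0" "total_deg w = d" using v w by auto
        then show "Poly_Mapping.lookup v i \<le> 1" using v w by simp
      qed
    qed
    moreover have "monomial ` squarefree_exponents d \<subseteq> J"
    proof (rule image_subsetI)
      fix b :: "'n \<Rightarrow>\<^sub>0 nat" assume "b \<in> squarefree_exponents d"
      then show "monomial b \<in> J" unfolding squarefree_exponents_iff by (simp add: J_def)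
    qed
    ultimately have "?I \<subseteq> J" unfolding monomial_ideal_def by (rule genideal_type_algebra_least)
    then show ?thesis using that by (auto simp: J_def)
  qed
  have "\<forall>v\<in>Poly_Mapping.keys a. total_deg v = j * d \<longrightarrow> Poly_Mapping.lookup v i \<le> j"
    if "a \<in> ideal_power ?I j" for a
    using that
  proof (induction j arbitrary: a)
    case (Suc j)
    from Suc.prems have "a \<in> ideal_power ?I j \<cdot>\<^bsub>mpoly_ring\<^esub> ?I" by (simp only: ideal_power_Suc)
    then show ?case
    proof (induction rule: ideal_prod.induct)
      case (prod a b)
      show ?case
      proof (intro ballI impI)
        fix v assume "v \<in> Poly_Mapping.keys (a \<otimes>\<^bsub>mpoly_ring\<^esub> b)" and v_deg: "total_deg v = Suc j * d"
        then obtain u w where v: "v = u + w" "u \<in> Poly_Mapping.keys a" "w \<in> Poly_Mapping.keys b"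
          using keys_mult[of a b] by auto
        have "j * d \<le> total_deg u" using ideal_power_keys[OF prod(1) v(2)] .
        moreover have "d \<le> total_deg w" using I_keys[OF prod(2) v(3)] .
        ultimately have deg: "total_deg u = j * d" "total_deg w = d" using v(1) v_deg by simp_all
        have "Poly_Mapping.lookup u i \<le> j" using Suc.IH[OF prod(1)] v(2) deg by blast
        moreover have "Poly_Mapping.lookup w i \<le> 1" using base[OF prod(2) v(3) deg(2)] .
        ultimately show "Poly_Mapping.lookup v i \<le> Suc j" by (simp add: v(1) lookup_add)
      qed
    next
      case (sum a b)
      then show ?case using keys_add[of a b] by auto
    qed
  qed simp
  then show ?thesis using assms by blast
qed

theorem analytic_spread_squarefree:
  assumes d_bounds: "0 < d" "d < CARD('n)"
  shows "analytic_spread (monomial_ideal (squarefree_exponents d) :: ('n::finite, 'k::field) mpoly set) = enat CARD('n)"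
proof (rule antisym)
  interpret equigenerated "monomial ` squarefree_exponents d :: ('n, 'k) mpoly set" d
      "monomial_ideal (squarefree_exponents d)"
    by (rule equigenerated_squarefree[OF d_bounds(1)]) (rule eq_reflection[OF monomial_ideal_def])
  let ?I = "monomial_ideal (squarefree_exponents d) :: ('n, 'k) mpoly set"
  show "analytic_spread ?I \<le> enat CARD('n)" by (rule analytic_spread_le)
  show "enat CARD('n) \<le> analytic_spread ?I"
    unfolding analytic_spread_eq
  proof (rule krull_dim_squarefree_algebra_ge[OF d_bounds cring_form_algebra])
    fix p v i assume p: "p \<in> form_algebra" and v: "v \<in> Poly_Mapping.keys p"
    then have "d dvd total_deg v" by (simp add: form_algebra_def)
    then obtain j where "total_deg v = d * j" by (rule dvdE)
    then have j: "total_deg v = j * d" by (simp only: mult.commute)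
    have "Poly_Mapping.lookup v i \<le> j"
    proof (rule squarefree_power_keys[OF d_bounds(1) _ _ j])
      show "hom_comp (j * d) p \<in> ideal_power ?I j" using p by (simp add: form_algebra_def)
      show "v \<in> Poly_Mapping.keys (hom_comp (j * d) p)" using v j by simp
    qed
    then show "d * Poly_Mapping.lookup v i \<le> total_deg v" by (simp add: j mult.commute)
  next
    fix b :: "'n \<Rightarrow>\<^sub>0 nat" assume b: "b \<in> squarefree_exponents d"
    have deg_b: "total_deg b = d" using b by (simp only: squarefree_exponents_iff)
    have "hom_comp (j * d) (monomial b) \<in> ideal_power ?I j" for j
    proof (cases "j = 1")
      case True
      have "monomial b \<in> ?I"
        unfolding monomial_ideal_def by (rule subsetD[OF subset_genideal_type_algebra]) (rule imageI[OF b])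
      then show ?thesis
        using deg_b True ideal_power_1[OF ideal_I] by (simp add: part_single)
    next
      case False
      then have "hom_comp (j * d) (monomial b) = (0 :: ('n, 'k) mpoly)"
        using deg_b d_bounds by (simp add: part_single when_def)
      then show ?thesis using ideal_pow by (simp add: ideal_type_algebra_iff)
    qed
    then show "monomial b \<in> form_algebra"
      using deg_b by (simp add: form_algebra_def)
  qed
qed

section \<open>Counting the generators of the square\<close>

lemma card_squarefree_exponents:
  "card (squarefree_exponents d :: ('n::finite \<Rightarrow>\<^sub>0 nat) set) = CARD('n) choose d"
proof -
  have "card (squarefree_exponents d :: ('n \<Rightarrow>\<^sub>0 nat) set) = card {S :: 'n set. card S = d}"
    unfolding squarefree_exponents_def by (rule card_image) (rule inj_on_subset[OF inj_indicator_exponent], simp)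
  also have "\<dots> = CARD('n) choose d"
    using n_subsets[of "UNIV :: 'n set" d] by simp
  finally show ?thesis .
qed

text \<open>
  To split \<open>v\<close> into two squarefree exponents, put its entries \<open>2\<close> into both parts and distribute
  its entries \<open>1\<close> evenly.
\<close>

lemma squarefree_exponents_sumset:
  "(\<lambda>(a, b). a + b) ` (squarefree_exponents d \<times> squarefree_exponents d) =
     {v :: 'n::finite \<Rightarrow>\<^sub>0 nat. total_deg v = 2 * d \<and> (\<forall>i. Poly_Mapping.lookup v i \<le> 2)}" (is "?L = ?R")
proof
  show "?L \<subseteq> ?R"
  proof clarify
    fix a b :: "'n \<Rightarrow>\<^sub>0 nat" assume "a \<in> squarefree_exponents d" "b \<in> squarefree_exponents d"
    then have "total_deg a = d" "total_deg b = d" "\<forall>i. Poly_Mapping.lookup a i \<le> 1" "\<forall>i. Poly_Mapping.lookup b i \<le> 1"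
      by (simp_all add: squarefree_exponents_iff)
    then have "Poly_Mapping.lookup a i \<le> 1" "Poly_Mapping.lookup b i \<le> 1" for i by blast+
    then have "Poly_Mapping.lookup a i + Poly_Mapping.lookup b i \<le> 2" for i
      using add_mono by (metis one_add_one)
    with \<open>total_deg a = d\<close> \<open>total_deg b = d\<close>
    show "total_deg (a + b) = 2 * d \<and> (\<forall>i. Poly_Mapping.lookup (a + b) i \<le> 2)"
      by (simp add: lookup_add)
  qed
  show "?R \<subseteq> ?L"
  proof
    fix v :: "'n \<Rightarrow>\<^sub>0 nat" assume v: "v \<in> ?R"
    define T where "T = {i. Poly_Mapping.lookup v i = 2}"
    define U where "U = {i. Poly_Mapping.lookup v i = 1}"
    have cases: "Poly_Mapping.lookup v i = (if i \<in> T then 2 else if i \<in> U then 1 else 0)" for i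
    proof -
      have "Poly_Mapping.lookup v i \<le> 2" using v by simp
      then show ?thesis by (auto simp: T_def U_def)
    qed
    have disj: "T \<inter> U = {}" by (auto simp: T_def U_def)
    have "v = indicator_exponent T + indicator_exponent T + indicator_exponent U"
      by (rule poly_mapping_eqI) (use disj in \<open>auto simp: lookup_add cases\<close>)
    then have "total_deg v = card T + card T + card U" by simp
    then have card: "2 * d = 2 * card T + card U" using v by simp
    then have "d - card T \<le> card U" by simp
    then obtain U' where U': "U' \<subseteq> U" "card U' = d - card T" by (meson obtain_subset_with_card_n)
    have "card (T \<union> U') = d"
      using disj U' card by (subst card_Un_disjoint) auto
    moreover have "card (T \<union> (U - U')) = d"
      using disj U' card by (subst card_Un_disjoint) (auto simp: card_Diff_subset)
    moreover have "v = indicator_exponent (T \<union> U') + indicator_exponent (T \<union> (U - U'))"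
      by (rule poly_mapping_eqI) (use disj U' in \<open>auto simp: lookup_add cases\<close>)
    ultimately show "v \<in> ?L"
      by (auto simp: squarefree_exponents_def image_iff intro!: bexI[of _ "(indicator_exponent (T \<union> U'), indicator_exponent (T \<union> (U - U')))"])
  qed
qed

text \<open>
  A vector with entries at most \<open>2\<close> is given by the set \<open>T\<close> of its entries \<open>2\<close> and the disjoint set
  \<open>U\<close> of its entries \<open>1\<close>; the index \<open>j\<close> is the cardinality of \<open>T\<close>.
\<close>

lemma card_bounded_exponents:
  "card {v :: 'n::finite \<Rightarrow>\<^sub>0 nat. total_deg v = 2 * d \<and> (\<forall>i. Poly_Mapping.lookup v i \<le> 2)} =
     (\<Sum>j\<le>d. (CARD('n) choose j) * ((CARD('n) - j) choose (2 * (d - j))))" (is "card ?V = _")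
proof -
  define W where "W = (SIGMA j:{..d}. SIGMA T:{T :: 'n set. card T = j}. {U. U \<subseteq> - T \<and> card U = 2 * (d - j)})"
  define h where "h = (\<lambda>(j :: nat, T :: 'n set, U). indicator_exponent T + indicator_exponent T + indicator_exponent U)"
  have lookup_h: "Poly_Mapping.lookup (h (j, T, U)) i = (if i \<in> T then 2 else if i \<in> U then 1 else 0)"
    if "U \<subseteq> - T" for j T U i
    using that by (auto simp: h_def lookup_add)
  have "bij_betw h W ?V"
    unfolding bij_betw_def
  proof (intro conjI subset_antisym)
    show "inj_on h W"
    proof (rule inj_onI)
      fix x y assume xy: "x \<in> W" "y \<in> W" "h x = h y"
      obtain j T U where x: "x = (j, T, U)" by (cases x)
      obtain j' T' U' where y: "y = (j', T', U')" by (cases y)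
      have 1: "j = card T" "U \<subseteq> - T" "j' = card T'" "U' \<subseteq> - T'" using xy x y by (auto simp: W_def)
      have eq: "(if i \<in> T then 2 else if i \<in> U then 1 else (0::nat)) = (if i \<in> T' then 2 else if i \<in> U' then 1 else 0)" for i
        using arg_cong[OF xy(3), of "\<lambda>v. Poly_Mapping.lookup v i"] lookup_h 1 x y by simp
      have "i \<in> T \<longleftrightarrow> i \<in> T'" "i \<in> U \<longleftrightarrow> i \<in> U'" for i
        using eq[of i] 1 by (auto split: if_splits)
      then have "T = T'" "U = U'" by blast+
      then show "x = y" using 1 x y by simp
    qed
    show "h ` W \<subseteq> ?V"
    proof clarify
      fix j T U assume "(j, T, U) \<in> W"
      then have w: "j \<le> d" "card T = j" "U \<subseteq> - T" "card U = 2 * (d - j)" by (auto simp: W_def)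
      then show "total_deg (h (j, T, U)) = 2 * d \<and> (\<forall>i. Poly_Mapping.lookup (h (j, T, U)) i \<le> 2)"
        by (simp add: lookup_h) (simp add: h_def)
    qed
    show "?V \<subseteq> h ` W"
    proof
      fix v assume v: "v \<in> ?V"
      define T where "T = {i. Poly_Mapping.lookup v i = 2}"
      define U where "U = {i. Poly_Mapping.lookup v i = 1}"
      have disj: "U \<subseteq> - T" by (auto simp: T_def U_def)
      have "v = h (card T, T, U)"
      proof (rule poly_mapping_eqI)
        fix i
        have "Poly_Mapping.lookup v i \<le> 2" using v by simp
        then show "Poly_Mapping.lookup v i = Poly_Mapping.lookup (h (card T, T, U)) i"
          unfolding lookup_h[OF disj] by (auto simp: T_def U_def)
      qed
      moreover from this have "total_deg v = 2 * card T + card U" by (simp add: h_def)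
      then have "(card T, T, U) \<in> W" using v disj by (auto simp: W_def)
      ultimately show "v \<in> h ` W" by blast
    qed
  qed
  then have "card ?V = card W" by (simp add: bij_betw_same_card)
  also have "\<dots> = (\<Sum>j\<le>d. \<Sum>T\<in>{T :: 'n set. card T = j}. card {U. U \<subseteq> - T \<and> card U = 2 * (d - j)})"
    unfolding W_def by (simp add: card_SigmaI)
  also have "\<dots> = (\<Sum>j\<le>d. \<Sum>T\<in>{T :: 'n set. card T = j}. (CARD('n) - j) choose (2 * (d - j)))"
    by (intro sum.cong refl) (simp add: n_subsets Compl_eq_Diff_UNIV card_Diff_subset)
  also have "\<dots> = (\<Sum>j\<le>d. (CARD('n) choose j) * ((CARD('n) - j) choose (2 * (d - j))))"
    using n_subsets[of "UNIV :: 'n set"] by simp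
  finally show ?thesis .
qed

text \<open>
  The number of vectors in \<open>{0,1,2}\<^sup>n\<close> with coordinate sum \<open>2 d\<close>, sorted by the number \<open>j\<close> of entries \<open>2\<close>.
\<close>

definition square_count :: "nat \<Rightarrow> nat \<Rightarrow> nat" where
  "square_count n d = (\<Sum>j\<le>d. (n choose j) * ((n - j) choose (2 * (d - j))))"

lemma square_count_1: "1 \<le> n \<Longrightarrow> square_count n 1 = (n choose 2) + n"
  by (simp add: square_count_def numeral_2_eq_2)

lemma square_count_minus_1:
  assumes "2 \<le> n" shows "square_count n (n - 1) = (n choose 2) + n"
proof -
  obtain m where n: "n = m + 2" using assms by (metis add.commute le_Suc_ex)
  have "square_count n (n - 1) = (\<Sum>j\<in>{m, m + 1}. (n choose j) * ((n - j) choose (2 * (n - 1 - j))))"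
    unfolding square_count_def
  proof (rule sum.mono_neutral_right)
    \<comment> \<open>If \<open>j < n - 2\<close>, there are fewer than \<open>2 (n - 1 - j)\<close> places left for the entries \<open>1\<close>.\<close>
    show "\<forall>j\<in>{..n - 1} - {m, m + 1}. (n choose j) * ((n - j) choose (2 * (n - 1 - j))) = 0"
      using n by (auto intro!: binomial_eq_0)
  qed (use n in auto)
  also have "\<dots> = ((m + 2) choose m) + ((m + 2) choose (m + 1))"
    using n by simp
  also have "\<dots> = (n choose 2) + n"
    using binomial_symmetric[of m "m + 2"] binomial_symmetric[of "m + 1" "m + 2"] n by simp
  finally show ?thesis .
qed

text \<open>
  With \<open>c = (n choose d)\<close> and \<open>m = n - d\<close>, the terms for \<open>j = d\<close>, \<open>d - 1\<close>, \<open>d - 2\<close> are \<open>c\<close>,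
  \<open>c d m / 2\<close> and \<open>c d (d - 1) m (m - 1) / 24\<close>.  If \<open>d\<close> and \<open>m\<close> are at least \<open>3\<close>, their sum is at least
  \<open>n c\<close>.  If \<open>d = 2\<close> or \<open>m = 2\<close>, it is larger than \<open>(n - 1) c\<close>, and then \<open>c = (n choose 2)\<close>.
  The proof uses \<open>a = d - 2\<close> and \<open>b = m - 2\<close>.
\<close>

lemma square_count_gt:
  assumes "2 \<le> d" "d + 2 \<le> n"
  shows "n * (n choose d) < square_count n d + (n choose 2)"
proof -
  obtain a where a: "d = a + 2" using assms(1) by (metis add.commute le_Suc_ex)
  obtain b where b: "n = a + b + 4" using assms(2) a
    by (metis add.assoc add.commute le_Suc_ex numeral_plus_numeral semiring_norm(2,6))
  define c where "c = real (n choose d)"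
  have "0 < c" using assms by (simp add: c_def)
  have c: "c = fact n / (fact (a + 2) * fact (b + 2))"
    unfolding c_def using a b by (simp add: binomial_fact)
  have T0: "real ((n choose d) * ((n - d) choose (2 * (d - d)))) = c" by (simp add: c_def)
  have T1: "real ((n choose (a + 1)) * ((n - (a + 1)) choose (2 * (d - (a + 1))))) =
      c * ((a + 2) * (b + 2) / 2)"
  proof -
    have *: "real (n choose (a + 1)) = fact n / (fact (a + 1) * fact (b + 3))"
        "real ((b + 3) choose 2) = fact (b + 3) / (2 * fact (b + 1))"
        "n - (a + 1) = b + 3" "2 * (d - (a + 1)) = 2"
      using a b by (simp_all add: binomial_fact add.commute)
    have c': "c = fact n / (((a + 2) * fact (a + 1)) * ((b + 2) * fact (b + 1)))"
      unfolding c by (simp add: algebra_simps)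
    have "(x / (y * g)) * (g / (2 * z)) = x / ((p * y) * (q * z)) * (p * q / 2)"
      if "y > 0" "g > 0" "z > 0" "p > 0" "q > 0" for x y z g p q :: real
      using that by (simp add: field_simps)
    from this[of "fact (a + 1)" "fact (b + 3)" "fact (b + 1)" "real (a + 2)" "real (b + 2)" "fact n"]
    show ?thesis unfolding of_nat_mult * c' by simp (simp add: algebra_simps)
  qed
  have T2: "real ((n choose a) * ((n - a) choose (2 * (d - a)))) =
      c * ((a + 2) * (a + 1) * (b + 2) * (b + 1) / 24)"
  proof -
    have *: "real (n choose a) = fact n / (fact a * fact (b + 4))"
        "real ((b + 4) choose 4) = fact (b + 4) / (24 * fact b)"
        "n - a = b + 4" "2 * (d - a) = 4"
      using a b by (simp_all add: binomial_fact add.commute fact_numeral)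
    have c': "c = fact n / (((a + 2) * (a + 1) * fact a) * ((b + 2) * (b + 1) * fact b))"
      unfolding c by (simp add: algebra_simps)
    have "(x / (y * g)) * (g / (24 * z)) = x / ((p * p' * y) * (q * q' * z)) * (p * p' * q * q' / 24)"
      if "y > 0" "g > 0" "z > 0" "p > 0" "q > 0" "p' > 0" "q' > 0" for x y z g p q p' q' :: real
      using that by (simp add: field_simps)
    from this[of "fact a" "fact (b + 4)" "fact b" "real (a + 2)" "real (b + 2)" "real (a + 1)" "real (b + 1)" "fact n"]
    show ?thesis unfolding of_nat_mult * c' by simp
  qed
  have "(\<Sum>j\<in>{a, a + 1, d}. (n choose j) * ((n - j) choose (2 * (d - j)))) \<le> square_count n d"
    unfolding square_count_def using a by (intro sum_mono2) auto
  then have "real (\<Sum>j\<in>{a, a + 1, d}. (n choose j) * ((n - j) choose (2 * (d - j)))) \<le> real (square_count n d)"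
    by (rule of_nat_mono)
  then have lower: "c * ((a + 2) * (a + 1) * (b + 2) * (b + 1) / 24) + c * ((a + 2) * (b + 2) / 2) + c
      \<le> real (square_count n d)"
    using a T0 T1 T2 by simp
  have "real n * c < real (square_count n d) + real (n choose 2)"
  proof (cases "a = 0 \<or> b = 0")
    case True
    then have "d = 2 \<or> d = n - 2" using a b by auto
    then have "n choose d = n choose 2"
      using b binomial_symmetric[of 2 n] by force
    then have eq: "real (n choose 2) = c" by (simp add: c_def)
    have "real n * c < c * ((a + 2) * (a + 1) * (b + 2) * (b + 1) / 24) + c * ((a + 2) * (b + 2) / 2) + c + c"
    proof -
      have "real n < (a + 2) * (a + 1) * (b + 2) * (b + 1) / 24 + (a + 2) * (b + 2) / 2 + 1 + 1"
        using True b by (auto simp: field_simps intro!: add_pos_nonneg)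
      then have "c * real n < c * ((a + 2) * (a + 1) * (b + 2) * (b + 1) / 24 + (a + 2) * (b + 2) / 2 + 1 + 1)"
        using \<open>0 < c\<close> by (rule mult_strict_left_mono)
      then show ?thesis by (simp add: algebra_simps)
    qed
    then show ?thesis using lower eq by linarith
  next
    case False
    then obtain x y where xy: "a = x + 1" "b = y + 1"
      by (metis Suc_eq_plus1 not0_implies_Suc)
    have "real n \<le> (a + 2) * (a + 1) * (b + 2) * (b + 1) / 24 + (a + 2) * (b + 2) / 2 + 1"
      using b xy by (simp add: field_simps)
    then have "c * real n \<le> c * ((a + 2) * (a + 1) * (b + 2) * (b + 1) / 24 + (a + 2) * (b + 2) / 2 + 1)"
      using \<open>0 < c\<close> by (intro mult_left_mono) auto
    then have "real n * c \<le> real (square_count n d)"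
      using lower by (simp add: algebra_simps)
    moreover have "0 < real (n choose 2)" using b by simp
    ultimately show ?thesis by linarith
  qed
  then have "real (n * (n choose d)) < real (square_count n d + (n choose 2))" by (simp add: c_def)
  then show ?thesis by (simp only: of_nat_less_iff)
qed

lemma two_times_choose_two: "2 * (n choose 2) + n = n * n"
  by (induction n) (auto simp: numeral_2_eq_2)

lemma square_count_eq_iff:
  assumes "0 < d" "d < n"
  shows "int (square_count n d) = int n * int (n choose d) - int (n choose 2) \<longleftrightarrow> d = 1 \<or> d = n - 1"
proof -
  have "int (square_count n d) = int n * int (n choose d) - int (n choose 2) \<longleftrightarrow>
      int (square_count n d + (n choose 2)) = int (n * (n choose d))" by auto
  also have "\<dots> \<longleftrightarrow> square_count n d + (n choose 2) = n * (n choose d)"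
    by (simp only: of_nat_eq_iff)
  also have "\<dots> \<longleftrightarrow> d = 1 \<or> d = n - 1"
  proof (cases "d = 1 \<or> d = n - 1")
    case True
    have "n choose (n - 1) = n"
      using binomial_symmetric[of 1 n] assms by simp
    then have "n choose d = n" using True by auto
    moreover have "square_count n d = (n choose 2) + n"
      using True square_count_1[of n] square_count_minus_1[of n] assms by auto
    ultimately show ?thesis using True two_times_choose_two[of n] by simp
  next
    case False
    then show ?thesis using square_count_gt[of d n] assms by fastforce
  qed
  finally show ?thesis .
qed

theorem theorem3p3:
  fixes d :: nat
  assumes "0 < d" and "d < CARD('n)"
  shows "freiman (veronese_ideal 1 d :: ('n::finite, 'k::field) mpoly set) \<longleftrightarrow>
    (CARD('n) = 2 \<and> d = 1) \<or>
    (CARD('n) \<ge> 3 \<and> (d = 1 \<or> d = CARD('n) - 1))"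
proof -
  let ?n = "CARD('n)"
  let ?B = "squarefree_exponents d :: ('n \<Rightarrow>\<^sub>0 nat) set"
  let ?I = "monomial_ideal ?B :: ('n, 'k) mpoly set"
  have finB: "finite ?B" by (simp add: squarefree_exponents_def)
  have "min_gens mpoly_ring ?I = ?n choose d"
    using min_gens_monomial_ideal[OF finB, of d] by (simp add: squarefree_exponents_iff card_squarefree_exponents)
  moreover have "min_gens mpoly_ring (?I [^]\<^bsub>ideals_set mpoly_ring\<^esub> (2::nat)) = square_count ?n d"
  proof -
    let ?V = "{v :: 'n \<Rightarrow>\<^sub>0 nat. total_deg v = 2 * d \<and> (\<forall>i. Poly_Mapping.lookup v i \<le> 2)}"
    have "finite ?V" unfolding squarefree_exponents_sumset[symmetric] using finB by simp
    then have "min_gens mpoly_ring (monomial_ideal ?V :: ('n, 'k) mpoly set) = card ?V"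
      by (rule min_gens_monomial_ideal) simp
    then show ?thesis
      unfolding ideal_power_def[symmetric] monomial_ideal_square squarefree_exponents_sumset
        card_bounded_exponents square_count_def .
  qed
  ultimately have "freiman ?I \<longleftrightarrow> int (square_count ?n d) = int ?n * int (?n choose d) - int (?n choose 2)"
    unfolding freiman_def analytic_spread_squarefree[OF assms] by auto
  also have "\<dots> \<longleftrightarrow> d = 1 \<or> d = ?n - 1"
    using assms by (rule square_count_eq_iff)
  also have "\<dots> \<longleftrightarrow> (?n = 2 \<and> d = 1) \<or> (?n \<ge> 3 \<and> (d = 1 \<or> d = ?n - 1))"
    using assms by auto
  finally show ?thesis unfolding veronese_ideal_eq .
qed

end
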